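(* Let $x_0\in\mathbb{R}^2$ and let $X=C(\mathbb{R}^2-\{x_0\},2)$ be the unordered configuration space of two distinct points in $\mathbb{R}^2-\{x_0\}$. Then $$\mathrm{GC}(X)=\mathrm{TC}(X)=3.$$
   Context: $C(\mathbb{R}^2-\{x_0\},2)$ is the space of two-element subsets $\{a,a'\}$ of $\mathbb{R}^2-\{x_0\}$, with the metric $$d(\{a,a'\},\{b,b'\})=\min\bigl(d((a,a'),(b,b')),\,d((a,a'),(b',b))\bigr),$$ where $d$ on the right is the Euclidean metric on $\mathbb{R}^2\times\mathbb{R}^2$. Let $I=[0,1]$. For a topological space $Z$, $P(Z)=Z^I$ is the space of continuous maps $I\to Z$ with the compact-open topology, and $P(Z;z_0,z_1)$ is the subspace of paths from $z_0$ to $z_1$. The length of a path in a metric space is the supremum of the sums of distances between successive points on the path. A (minimal) geodesic from $x_0$ to $x_1$ in a metric space $(Z,d)$ is a path $\gamma$ from $x_0$ to $x_1$ with $d(\gamma(t),\gamma(t'))=|t-t'|\,d(x_0,x_1)$ for all $t,t'\in I$. A metric space is geodesic if every pair of its points is joined by a geodesic. Let $X$ be a metric space whose completion $\overline{X}$ is geodesic. For $x_0,x_1\in X$, a near-geodesic from $x_0$ to $x_1$ is a continuous map $\phi:I\to P(\overline{X};x_0,x_1)$ such that (i) $\phi(0)$ is a geodesic in $\overline{X}$ from $x_0$ to $x_1$; (ii) $\phi((0,1])\subset P(X;x_0,x_1)$; (iii) if $s_n\to 0$, then $\operatorname{length}(\phi(s_n))\to\operatorname{length}(\phi(0))$. For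 $E\subset X\times X$, a near-geodesic motion planning rule (NGMPR) on $E$ is a continuous map $\Phi:E\to P(\overline{X})^I$ such that, for all $(x_0,x_1)\in E$, $\Phi(x_0,x_1)$ is a near-geodesic from $x_0$ to $x_1$, with the additional proviso that $\Phi(x_0,x_1)(0)$ is a geodesic in $X$ if a geodesic in $X$ from $x_0$ to $x_1$ exists. The geodesic complexity $\mathrm{GC}(X)$ is the smallest $k$ such that $X\times X$ can be partitioned into locally compact sets $E_0,\ldots,E_k$ such that each $E_i$ has an NGMPR. The topological complexity $\mathrm{TC}(X)$ of a topological space $X$ (Farber, reduced version) is the smallest $k$ such that $X\times X$ can be partitioned into locally compact sets $E_0,\ldots,E_k$ on each of which there is a continuous map $s_i:E_i\to P(X)$ with $s_i(x_0,x_1)$ a path from $x_0$ to $x_1$ for all $(x_0,x_1)\in E_i$. *)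

theory Defs
  imports "HOL-Analysis.Analysis" "HOL-Library.Extended_Nat"
begin

section \<open>The unordered configuration space of two points\<close>

definition conf2 :: "'a set \<Rightarrow> 'a set set" where
  "conf2 S = {A. A \<subseteq> S \<and> card A = 2}"

text \<open>The distance on the product type is the Euclidean one,
  \<open>dist (a,a') (b,b') = sqrt ((dist a b)\<^sup>2 + (dist a' b')\<^sup>2)\<close>. The right-hand side below does not
  depend on the enumeration of the two sets (lemma \<open>conf2_dist_eq\<close>).\<close>

definition conf2_dist :: "'a::metric_space set \<Rightarrow> 'a set \<Rightarrow> real" where
  "conf2_dist A B = (THE r. \<exists>a a' b b'. A = {a, a'} \<and> B = {b, b'} \<and>
     r = min (dist (a, a') (b, b')) (dist (a, a') (b', b)))"

text \<open>\<^const>\<open>Metric_space\<close> asks for nonnegativity and symmetry outside the carrier too,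
  hence the default value 0.\<close>

definition conf2_metric :: "'a::metric_space set \<Rightarrow> 'a set metric" where
  "conf2_metric S = metric (conf2 S,
     \<lambda>A B. if A \<in> conf2 S \<and> B \<in> conf2 S then conf2_dist A B else 0)"

lemma dist_pair_swap: "dist (a', a) (b', b) = dist (a, a') (b, b')"
  by (simp add: dist_Pair_Pair add.commute)

lemma conf2_dist_eq:
  "conf2_dist {a, a'} {b, b'} = min (dist (a, a') (b, b')) (dist (a, a') (b', b))"
  unfolding conf2_dist_def
proof (rule the_equality)
  have swap: "dist (a', a) (b', b) = dist (a, a') (b, b')"
    "dist (a', a) (b, b') = dist (a, a') (b', b)"
    by (rule dist_pair_swap)+
  fix r
  assume "\<exists>c c' e e'. {a, a'} = {c, c'} \<and> {b, b'} = {e, e'} \<and>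
     r = min (dist (c, c') (e, e')) (dist (c, c') (e', e))"
  then obtain c c' e e' where
    "c = a \<and> c' = a' \<or> c = a' \<and> c' = a" "e = b \<and> e' = b' \<or> e = b' \<and> e' = b"
    "r = min (dist (c, c') (e, e')) (dist (c, c') (e', e))"
    unfolding doubleton_eq_iff by blast
  then show "r = min (dist (a, a') (b, b')) (dist (a, a') (b', b))"
    by (elim disjE conjE) (simp_all only: swap min.commute)
qed blast

lemma conf2_cases:
  assumes "A \<in> conf2 S"
  obtains a a' where "A = {a, a'}" "a \<noteq> a'" "a \<in> S" "a' \<in> S"
  using assms unfolding conf2_def by (auto simp: card_2_iff)

lemma conf2_dist_commute:
  assumes "A \<in> conf2 S" "B \<in> conf2 S"
  shows "conf2_dist A B = conf2_dist B A"
proof -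
  obtain a a' b b' where *: "A = {a, a'}" "B = {b, b'}"
    using assms by (elim conf2_cases)
  have "dist (b, b') (a', a) = dist (a, a') (b', b)"
    using dist_pair_swap[of b' b a a'] by (simp only: dist_commute)
  then show ?thesis
    unfolding * conf2_dist_eq by (simp only: dist_commute)
qed

lemma conf2_dist_triangle:
  assumes "A \<in> conf2 S" "B \<in> conf2 S" "C \<in> conf2 S"
  shows "conf2_dist A C \<le> conf2_dist A B + conf2_dist B C"
proof -
  obtain a a' b b' c c' where *: "A = {a, a'}" "B = {b, b'}" "C = {c, c'}"
    using assms by (elim conf2_cases)
  have "dist (a, a') (c, c') \<le> dist (a, a') (b, b') + dist (b, b') (c, c')"
    "dist (a, a') (c', c) \<le> dist (a, a') (b, b') + dist (b, b') (c', c)"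
    "dist (a, a') (c', c) \<le> dist (a, a') (b', b) + dist (b', b) (c', c)"
    "dist (a, a') (c, c') \<le> dist (a, a') (b', b) + dist (b', b) (c, c')"
    by (rule dist_triangle)+
  moreover have "dist (b', b) (c', c) = dist (b, b') (c, c')"
    "dist (b', b) (c, c') = dist (b, b') (c', c)"
    by (rule dist_pair_swap)+
  ultimately show ?thesis
    unfolding * conf2_dist_eq by linarith
qed

lemma Metric_space_conf2:
  "Metric_space (conf2 S)
     (\<lambda>A B. if A \<in> conf2 S \<and> B \<in> conf2 S then conf2_dist A B else 0)"
proof
  fix A B
  show "0 \<le> (if A \<in> conf2 S \<and> B \<in> conf2 S then conf2_dist A B else 0)"
    by (auto elim!: conf2_cases simp: conf2_dist_eq)
  show "(if A \<in> conf2 S \<and> B \<in> conf2 S then conf2_dist A B else 0) =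
        (if B \<in> conf2 S \<and> A \<in> conf2 S then conf2_dist B A else 0)"
    by (auto intro: conf2_dist_commute)
next
  fix A B assume AB: "A \<in> conf2 S" "B \<in> conf2 S"
  then obtain a a' b b' where *: "A = {a, a'}" "B = {b, b'}"
    by (elim conf2_cases)
  have "min p q = 0 \<longleftrightarrow> p = 0 \<or> q = 0" if "0 \<le> p" "0 \<le> q" for p q :: real
    using that by (auto simp: min_def)
  then have "conf2_dist A B = 0 \<longleftrightarrow> (a, a') = (b, b') \<or> (a, a') = (b', b)"
    unfolding * conf2_dist_eq by (simp only: zero_le_dist dist_eq_0_iff)
  then show "((if A \<in> conf2 S \<and> B \<in> conf2 S then conf2_dist A B else 0) = 0) = (A = B)"
    using AB by (simp add: * doubleton_eq_iff)
next
  fix A B C assume "A \<in> conf2 S" "B \<in> conf2 S" "C \<in> conf2 S"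
  then show "(if A \<in> conf2 S \<and> C \<in> conf2 S then conf2_dist A C else 0) \<le>
    (if A \<in> conf2 S \<and> B \<in> conf2 S then conf2_dist A B else 0) +
    (if B \<in> conf2 S \<and> C \<in> conf2 S then conf2_dist B C else 0)"
    by (simp add: conf2_dist_triangle)
qed

lemma mspace_conf2_metric [simp]: "mspace (conf2_metric S) = conf2 S"
  by (simp add: conf2_metric_def Metric_space.mspace_metric[OF Metric_space_conf2])

lemma mdist_conf2_metric:
  assumes "A \<in> conf2 S" "B \<in> conf2 S"
  shows "mdist (conf2_metric S) A B = conf2_dist A B"
  using assms by (simp add: conf2_metric_def Metric_space.mdist_metric[OF Metric_space_conf2])


section \<open>Mapping spaces and path spaces\<close>

text \<open>The compact-open topology. Its points are represented by extensional functions, so that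
  each continuous map on \<^term>\<open>topspace X\<close> is represented exactly once.\<close>

definition map_set :: "'a topology \<Rightarrow> 'b topology \<Rightarrow> ('a \<Rightarrow> 'b) set" where
  "map_set X Y = {f. continuous_map X Y f \<and> f \<in> extensional (topspace X)}"

definition compact_open_topology :: "'a topology \<Rightarrow> 'b topology \<Rightarrow> ('a \<Rightarrow> 'b) topology" where
  "compact_open_topology X Y = topology_generated_by
     {{f \<in> map_set X Y. f ` K \<subseteq> U} | K U. compactin X K \<and> openin Y U}"

lemma topspace_compact_open_topology [simp]:
  "topspace (compact_open_topology X Y) = map_set X Y"
proof -
  have "map_set X Y \<in> {{f \<in> map_set X Y. f ` K \<subseteq> U} | K U. compactin X K \<and> openin Y U}"
    by (rule CollectI, rule exI[of _ "{}"], rule exI[of _ "{}"]) auto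
  then show ?thesis
    unfolding compact_open_topology_def topology_generated_by_topspace by blast
qed

abbreviation unit_interval :: "real topology" where
  "unit_interval \<equiv> top_of_set {0..1}"

definition path_space :: "'a topology \<Rightarrow> (real \<Rightarrow> 'a) topology" where
  "path_space Z = compact_open_topology unit_interval Z"

definition path_space_between :: "'a topology \<Rightarrow> 'a \<Rightarrow> 'a \<Rightarrow> (real \<Rightarrow> 'a) topology" where
  "path_space_between Z z0 z1 = subtopology (path_space Z) {\<gamma>. \<gamma> 0 = z0 \<and> \<gamma> 1 = z1}"

definition path_length :: "'a metric \<Rightarrow> (real \<Rightarrow> 'a) \<Rightarrow> ereal" where
  "path_length Z \<gamma> = (SUP (n, t) \<in> {(n :: nat, t). mono_on {..n} t \<and> t ` {..n} \<subseteq> {0..1}}.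
     ereal (\<Sum>i<n. mdist Z (\<gamma> (t i)) (\<gamma> (t (Suc i)))))"

definition geodesic :: "'a metric \<Rightarrow> 'a \<Rightarrow> 'a \<Rightarrow> (real \<Rightarrow> 'a) \<Rightarrow> bool" where
  "geodesic Z x0 x1 \<gamma> \<longleftrightarrow>
     \<gamma> \<in> topspace (path_space_between (mtopology_of Z) x0 x1) \<and>
     (\<forall>t\<in>{0..1}. \<forall>t'\<in>{0..1}. mdist Z (\<gamma> t) (\<gamma> t') = \<bar>t - t'\<bar> * mdist Z x0 x1)"


section \<open>Completions\<close>

text \<open>The library shows that every metric space has a completion (an isometric embedding onto a
  dense subset of a complete space) and realises it on the type \<^typ>\<open>'a \<Rightarrow> real\<close>. As completions
  are unique up to isometry, we fix one by choice.\<close>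

definition is_completion :: "'a metric \<Rightarrow> 'b metric \<Rightarrow> ('a \<Rightarrow> 'b) \<Rightarrow> bool" where
  "is_completion X Y i \<longleftrightarrow> mcomplete_of Y \<and> i \<in> mspace X \<rightarrow> mspace Y \<and>
     mtopology_of Y closure_of (i ` mspace X) = mspace Y \<and>
     (\<forall>x\<in>mspace X. \<forall>y\<in>mspace X. mdist Y (i x) (i y) = mdist X x y)"

definition some_completion :: "'a metric \<Rightarrow> ('a \<Rightarrow> real) metric \<times> ('a \<Rightarrow> 'a \<Rightarrow> real)" where
  "some_completion X = (SOME (Y, i). is_completion X Y i)"

definition mcompletion :: "'a metric \<Rightarrow> ('a \<Rightarrow> real) metric" where
  "mcompletion X = fst (some_completion X)"

definition to_mcompletion :: "'a metric \<Rightarrow> 'a \<Rightarrow> ('a \<Rightarrow> real)" where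
  "to_mcompletion X = snd (some_completion X)"

lemma is_completion_mcompletion: "is_completion X (mcompletion X) (to_mcompletion X)"
proof -
  obtain i :: "'a \<Rightarrow> 'a \<Rightarrow> real" and Y where "mcomplete_of Y" "i \<in> mspace X \<rightarrow> mspace Y"
    "mtopology_of Y closure_of (i ` mspace X) = mspace Y"
    "\<And>x y. \<lbrakk>x \<in> mspace X; y \<in> mspace X\<rbrakk> \<Longrightarrow> mdist Y (i x) (i y) = mdist X x y"
    by (rule Metric_space.metric_completion[OF Metric_space_mspace_mdist]) (rule that)
  then have "is_completion X Y i"
    unfolding is_completion_def by blast
  then have "case some_completion X of (Y, i) \<Rightarrow> is_completion X Y i"
    unfolding some_completion_def by (intro someI[of "\<lambda>(Y, i). is_completion X Y i" "(Y, i)"]) simp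
  then show ?thesis
    by (simp add: mcompletion_def to_mcompletion_def case_prod_beta)
qed


section \<open>Geodesic complexity and topological complexity\<close>

text \<open>Here \<open>X\<close> is a metric subspace of \<open>Y\<close>; it is used with \<open>Y\<close> the completion of \<open>X\<close>.\<close>

definition near_geodesic ::
    "'b metric \<Rightarrow> 'b metric \<Rightarrow> 'b \<Rightarrow> 'b \<Rightarrow> (real \<Rightarrow> real \<Rightarrow> 'b) \<Rightarrow> bool" where
  "near_geodesic Y X x0 x1 \<phi> \<longleftrightarrow>
     continuous_map unit_interval (path_space_between (mtopology_of Y) x0 x1) \<phi> \<and>
     geodesic Y x0 x1 (\<phi> 0) \<and>
     \<phi> ` {0<..1} \<subseteq> topspace (path_space_between (mtopology_of X) x0 x1) \<and>
     (\<forall>s :: nat \<Rightarrow> real. range s \<subseteq> {0..1} \<and> s \<longlonglongrightarrow> 0 \<longrightarrow>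
        (\<lambda>n. path_length Y (\<phi> (s n))) \<longlonglongrightarrow> path_length Y (\<phi> 0))"

text \<open>\<open>X'\<close> is the copy of \<open>X\<close> inside its completion \<open>Y\<close>.\<close>

definition ngmpr ::
    "'a metric \<Rightarrow> ('a \<times> 'a) set \<Rightarrow> ('a \<times> 'a \<Rightarrow> real \<Rightarrow> real \<Rightarrow> ('a \<Rightarrow> real)) \<Rightarrow> bool" where
  "ngmpr X E \<Phi> \<longleftrightarrow>
     (let Y = mcompletion X; i = to_mcompletion X; X' = submetric Y (i ` mspace X) in
       continuous_map (subtopology (prod_topology (mtopology_of X) (mtopology_of X)) E)
         (compact_open_topology unit_interval (path_space (mtopology_of Y))) \<Phi> \<and>
       (\<forall>(x0, x1) \<in> E.
          near_geodesic Y X' (i x0) (i x1) (\<Phi> (x0, x1)) \<and>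
          ((\<exists>\<gamma>. geodesic X' (i x0) (i x1) \<gamma>) \<longrightarrow> geodesic X' (i x0) (i x1) (\<Phi> (x0, x1) 0))))"

text \<open>A partition of \<^term>\<open>Z \<times> Z\<close> into locally compact sets \<open>E\<^sub>0, \<dots>, E\<^sub>k\<close>. Empty parts are
  allowed; deleting them only lowers \<open>k\<close>, so this does not affect the minima below.\<close>

definition lc_partition :: "'a topology \<Rightarrow> nat \<Rightarrow> (nat \<Rightarrow> ('a \<times> 'a) set) \<Rightarrow> bool" where
  "lc_partition Z k E \<longleftrightarrow>
     (\<Union>i\<le>k. E i) = topspace Z \<times> topspace Z \<and> disjoint_family_on E {..k} \<and>
     (\<forall>i\<le>k. locally_compact_space (subtopology (prod_topology Z Z) (E i)))"

text \<open>Both invariants are \<open>\<infinity>\<close> if no such \<open>k\<close> exists. Geodesic complexity is only meaningful for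
  spaces whose completion is geodesic.\<close>

definition GC :: "'a metric \<Rightarrow> enat" where
  "GC X = Inf {enat k | k. \<exists>E. lc_partition (mtopology_of X) k E \<and> (\<forall>i\<le>k. \<exists>\<Phi>. ngmpr X (E i) \<Phi>)}"

definition TC :: "'a topology \<Rightarrow> enat" where
  "TC Z = Inf {enat k | k. \<exists>E. lc_partition Z k E \<and>
     (\<forall>i\<le>k. \<exists>s. continuous_map (subtopology (prod_topology Z Z) (E i)) (path_space Z) s \<and>
        (\<forall>(z0, z1) \<in> E i. s (z0, z1) \<in> topspace (path_space_between Z z0 z1)))}"

end

theory Submission
  imports Defs
begin

text \<open>
  Write \<open>X\<close> for the configuration space. Evaluating a near-geodesic motion planning rule at the
  end of its deformation parameter gives a motion planning rule in \<open>X\<close>, so \<open>TC X \<le> GC X\<close>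
  (\<open>TC_le_GC\<close>), and it suffices to show \<open>3 \<le> TC X\<close> and \<open>GC X \<le> 3\<close>. The plane is identified
  isometrically with the complex plane, \<open>x\<^sub>0\<close> becoming \<open>0\<close>, and \<open>X\<close> is treated as the quotient of the
  ordered configurations by the swap.

  \<^bold>\<open>Lower bound\<close> (\<open>TC_ge_3\<close>). Let \<open>(u, v, w)\<close> run over \<open>\<real>\<^sup>3\<close> and consider motions from
  \<open>{cis (2\<pi>u), 2 cis (2\<pi>v)}\<close> to \<open>{3 + cis (\<pi>w), 3 - cis (\<pi>w)}\<close>. Both endpoints are invariant under integer
  translations. Along a motion the two moving points can be told apart by a continuous square root
  of the discriminant \<open>(a - a')\<^sup>2\<close>, and the total changes of the arguments of the two points and of the
  discriminant, compared with reference arguments at the end, are three integers. On a piece with a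
  continuous motion planning rule these integers are locally constant, and a suitable integer
  combination of them changes by exactly \<open>z\<close> when \<open>(u, v, w)\<close> is translated by \<open>z\<close>. (In terms of
  fundamental groups: a torus subgroup and a cyclic subgroup of the annular braid group have no
  nontrivial conjugate elements in common.) But \<open>\<real>\<^sup>n\<close> cannot be covered by \<open>n\<close> invariant sets with such
  equivariant locally constant labels in \<open>\<int>\<^sup>n\<close> (\<open>equivariant_labels_imp_card\<close>): averaging the labels
  with a partition of unity would give a map at bounded distance from the identity, hence onto a ball
  by Brouwer, whose values on a compact set lie in finitely many simplices of dimension less than \<open>n\<close>.

  \<^bold>\<open>Upper bound\<close> (\<open>GC_le_3\<close>). A geodesic in the completion moves the points of \<open>{a, a'}\<close> straight to the
  points of \<open>{b, b'}\<close> according to a shortest matching. A matching is shortest iff the inner product of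
  \<open>a - a'\<close> with the corresponding difference at the other end is nonnegative; then the two points
  never collide, and the only obstacle is a segment through \<open>0\<close> (a hit), which is removed by bending
  that segment to the left. Two discontinuities remain: the inner product may vanish (a tie, where
  one of the two matchings is selected by orientation, unless only the other one is free of hits), and segments may start to hit \<open>0\<close>. Each of these
  conditions has codimension one, and the strata \<open>E\<^sub>0, \<dots>, E\<^sub>3\<close> collect the pairs for which the total
  codimension is \<open>0, \<dots>, 3\<close>; in a tie the hits of both matchings are counted. With this count the
  codimension can only drop under small perturbations, and where it stays constant, the selected
  matching and its hits stay constant as well (\<open>near_codim\<close>). So the strata are locally closed and the
  rule is continuous on each of them. In a tie at most two of the four segments hit \<open>0\<close>, which bounds
  the codimension by \<open>3\<close>.
\<close>

section \<open>Lebesgue covering with lattice labels\<close>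

definition lattice :: "(real ^ 'n) set" where
  "lattice = {z. \<forall>i. z $ i \<in> \<int>}"

lemma lattice_add: "x \<in> lattice \<Longrightarrow> y \<in> lattice \<Longrightarrow> x + y \<in> lattice"
  and lattice_diff: "x \<in> lattice \<Longrightarrow> y \<in> lattice \<Longrightarrow> x - y \<in> lattice"
  and lattice_minus: "x \<in> lattice \<Longrightarrow> - x \<in> lattice"
  and lattice_0 [simp]: "0 \<in> lattice"
  by (simp_all add: lattice_def)

lemma lattice_dist_ge_1:
  assumes "x \<in> lattice" "y \<in> lattice" "x \<noteq> y"
  shows "1 \<le> dist x y"
proof -
  obtain i where "x $ i \<noteq> y $ i"
    using assms(3) by (auto simp: vec_eq_iff)
  moreover have "x $ i - y $ i \<in> \<int>"
    using assms by (simp add: lattice_def)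
  ultimately have "1 \<le> \<bar>(x - y) $ i\<bar>"
    using Ints_nonzero_abs_ge1[of "x $ i - y $ i"] by simp
  also have "\<dots> \<le> norm (x - y)"
    by (rule component_le_norm_cart)
  finally show ?thesis by (simp add: dist_norm)
qed

lemma finite_lattice_cball: "finite (lattice \<inter> cball a r)"
proof (rule ccontr)
  assume "infinite (lattice \<inter> cball a r)"
  then obtain l where "l islimpt (lattice \<inter> cball a r)"
    using compact_cball[of a r] unfolding compact_eq_Bolzano_Weierstrass
    by (metis inf_le2)
  then obtain x where x: "x \<in> lattice" "x \<noteq> l" "dist x l < 1 / 2"
    unfolding islimpt_approachable by (metis IntD1 half_gt_zero_iff zero_less_one)
  then obtain y where y: "y \<in> lattice" "y \<noteq> l" "dist y l < min (1 / 2) (dist x l)"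
    using \<open>l islimpt _\<close> unfolding islimpt_approachable
    by (metis (full_types) IntD1 min_less_iff_conj zero_less_dist_iff half_gt_zero_iff zero_less_one)
  then have "x \<noteq> y" by auto
  then have "1 \<le> dist x y" using lattice_dist_ge_1 x y by blast
  also have "dist x y \<le> dist x l + dist y l" by (rule dist_triangle2)
  finally show False using x y by simp
qed

lemma negligible_convex_hull_finite:
  fixes S :: "'a::euclidean_space set"
  assumes "finite S" "card S \<le> DIM('a)"
  shows "negligible (convex hull S)"
  using empty_interior_convex_hull[OF assms] negligible_convex_interior[OF convex_convex_hull] by blast

text \<open>Weighting the lattice points \<open>z\<close> by the distance of \<open>x - z\<close> to the complement of the tiles gives a
  continuous map \<open>F\<close> that moves points by a bounded amount. By Brouwer's theorem it covers a ball. At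
  each \<open>x\<close>, disjointness leaves at most one \<open>z\<close> of positive weight for each of the \<open>k + 1\<close> families,
  so the image of \<open>F\<close> lies in finitely many convex hulls of \<open>k + 1\<close> points. If \<open>k < n\<close>, these are
  negligible, a contradiction.\<close>
lemma lattice_translates_cover_imp_card:
  fixes V :: "nat \<Rightarrow> (real ^ 'n) set"
  assumes op: "\<And>i. i \<le> k \<Longrightarrow> open (V i)"
    and dis: "\<And>i x z w. \<lbrakk>i \<le> k; z \<in> lattice; w \<in> lattice; x - z \<in> V i; x - w \<in> V i\<rbrakk> \<Longrightarrow> z = w"
    and cov: "\<And>x. \<exists>i\<le>k. \<exists>z\<in>lattice. x - z \<in> V i"
  shows "CARD('n) \<le> k"
proof (rule ccontr)
  assume "\<not> CARD('n) \<le> k"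
  then have k: "k < DIM(real ^ 'n)" by simp
  define Q :: "(real ^ 'n) set" where "Q = cbox 0 1"
  obtain r0 where r0: "\<And>x. x \<in> Q \<Longrightarrow> \<exists>i\<le>k. \<exists>z\<in>lattice. x - z \<in> V i \<inter> ball 0 r0"
  proof -
    have "Q \<subseteq> \<Union> ((\<lambda>n. \<Union>i\<le>k. \<Union>z\<in>lattice. (+) z ` (V i \<inter> ball 0 (real n))) ` UNIV)"
    proof
      fix x assume "x \<in> Q"
      obtain i z where iz: "i \<le> k" "z \<in> lattice" "x - z \<in> V i" using cov by blast
      obtain n where "norm (x - z) < real n" using reals_Archimedean2 by blast
      then have "x \<in> (+) z ` (V i \<inter> ball 0 (real n))"
        using iz by (intro image_eqI[of _ _ "x - z"]) (auto simp: dist_norm norm_minus_commute)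
      then show "x \<in> \<Union> ((\<lambda>n. \<Union>i\<le>k. \<Union>z\<in>lattice. (+) z ` (V i \<inter> ball 0 (real n))) ` UNIV)"
        using iz by blast
    qed
    moreover have "compact Q" by (simp add: Q_def)
    moreover have "open (\<Union>i\<le>k. \<Union>z\<in>lattice. (+) z ` (V i \<inter> ball 0 (real n)))" for n
      using op by (intro open_UN ballI open_translation open_Int) auto
    ultimately obtain N where N: "finite N" "Q \<subseteq> (\<Union>n\<in>N. \<Union>i\<le>k. \<Union>z\<in>lattice. (+) z ` (V i \<inter> ball 0 (real n)))"
      by (metis (no_types, lifting) compactE_image)
    show thesis
    proof (rule that)
      fix x assume "x \<in> Q"
      then obtain n i z where n: "n \<in> N" "i \<le> k" "z \<in> lattice" "x - z \<in> V i \<inter> ball 0 (real n)"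
        using N(2) by force
      have "real n \<le> real (Max N)" using n(1) N(1) by simp
      then show "\<exists>i\<le>k. \<exists>z\<in>lattice. x - z \<in> V i \<inter> ball 0 (real (Max N))"
        using n by (intro exI[of _ i] conjI bexI[of _ z]) auto
    qed
  qed
  \<comment> \<open>Shrinking the tiles to the bounded sets \<open>W i\<close> keeps the covering property, as every point can be translated into the compact cube \<open>Q\<close>.\<close>
  define r where "r = max r0 0"
  define W where "W i = V i \<inter> ball 0 r" for i
  have covW: "\<exists>i\<le>k. \<exists>z\<in>lattice. x - z \<in> W i" for x
  proof -
    define f :: "real ^ 'n" where "f = (\<chi> j. of_int \<lfloor>x $ j\<rfloor>)"
    have "f \<in> lattice" by (simp add: f_def lattice_def)
    moreover have "(x - f) $ j = frac (x $ j)" for j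
      by (simp add: f_def frac_def)
    then have "x - f \<in> Q"
      by (simp add: Q_def mem_box_cart frac_lt_1 less_imp_le)
    then obtain i z where "i \<le> k" "z \<in> lattice" "x - f - z \<in> V i \<inter> ball 0 r0" using r0 by blast
    ultimately show ?thesis
      by (intro exI[of _ i] conjI bexI[of _ "f + z"])
        (auto simp: W_def r_def algebra_simps lattice_add)
  qed
  have opW: "open (W i)" if "i \<le> k" for i
    using op[OF that] by (auto simp: W_def)
  define f where "f i x = infdist x (- W i)" for i x
  have Wne: "- W i \<noteq> {}" for i
  proof -
    have "bounded (W i)" by (simp add: W_def bounded_Int)
    then show ?thesis using not_bounded_UNIV by (metis Compl_empty_eq double_compl)
  qed
  have fpos: "f i x > 0 \<longleftrightarrow> x \<in> W i" if "i \<le> k" for i x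
  proof -
    have "closed (- W i)" using opW[OF that] by auto
    then have "x \<in> - W i \<longleftrightarrow> f i x = 0"
      unfolding f_def using Wne in_closed_iff_infdist_zero by blast
    moreover have "f i x \<ge> 0" by (simp add: f_def infdist_nonneg)
    ultimately show ?thesis by force
  qed
  have fnn: "f i x \<ge> 0" for i x by (simp add: f_def infdist_nonneg)
  define B :: "(real ^ 'n) set" where "B = cball 0 (r + 1)"
  \<comment> \<open>Only the lattice points in \<open>Z\<close> have positive weight at a point of \<open>B\<close>.\<close>
  define Z :: "(real ^ 'n) set" where "Z = lattice \<inter> cball 0 (2 * r + 1)"
  have finZ: "finite Z" unfolding Z_def by (rule finite_lattice_cball)
  define N where "N = {..k} \<times> Z"
  define D where "D x = (\<Sum>(i,z)\<in>N. f i (x - z))" for x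
  define F where "F x = (\<Sum>(i,z)\<in>N. (f i (x - z) / D x) *\<^sub>R z)" for x
  have finN: "finite N" by (simp add: N_def finZ)
  have inZ: "z \<in> Z" if "x \<in> B" "x - z \<in> W i" "z \<in> lattice" for x z i
  proof -
    have "norm z \<le> norm x + norm (x - z)"
      using norm_triangle_sub[of z x] by (simp add: norm_minus_commute)
    with that show ?thesis by (auto simp: Z_def B_def W_def)
  qed
  have Dpos: "D x > 0" if "x \<in> B" for x
  proof -
    obtain i z where iz: "i \<le> k" "z \<in> lattice" "x - z \<in> W i" using covW by blast
    then have "(i, z) \<in> N" using inZ[OF that] by (simp add: N_def)
    then show ?thesis unfolding D_def
      using finN fnn fpos[of i "x - z"] iz by (intro sum_pos2[of _ "(i,z)"]) auto
  qed
  have contf: "continuous_on S (\<lambda>x. f i (x - z))" for S i z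
    unfolding f_def by (intro continuous_intros)
  have contF: "continuous_on B F"
    unfolding F_def D_def case_prod_unfold
  proof (intro continuous_intros contf ballI)
    fix x assume "x \<in> B"
    then show "(\<Sum>p\<in>N. f (fst p) (x - snd p)) \<noteq> 0"
      using Dpos[of x] by (simp add: D_def case_prod_unfold)
  qed
  have F_dist: "norm (x - F x) \<le> r" if "x \<in> B" for x
  proof -
    have 1: "(\<Sum>(i,z)\<in>N. f i (x - z) / D x) = 1"
      using Dpos[OF that] by (simp add: case_prod_unfold D_def flip: sum_divide_distrib)
    then have "x - F x = (\<Sum>(i,z)\<in>N. (f i (x - z) / D x) *\<^sub>R (x - z))"
      by (simp add: F_def case_prod_unfold scaleR_diff_right sum_subtractf flip: scaleR_left.sum)
    also have "norm \<dots> \<le> (\<Sum>(i,z)\<in>N. (f i (x - z) / D x) * r)"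
    proof (rule sum_norm_le)
      fix p assume "p \<in> N"
      then obtain i z where p: "p = (i, z)" and "i \<le> k" by (auto simp: N_def)
      have "\<bar>f i (x - z) / D x\<bar> * norm (x - z) \<le> f i (x - z) * r / D x"
      proof (cases "x - z \<in> W i")
        case True
        then have "norm (x - z) \<le> r" by (simp add: W_def)
        then show ?thesis using fnn[of i "x - z"] Dpos[OF that]
          by (simp add: divide_right_mono mult_left_mono)
      next
        case False
        then have "f i (x - z) = 0" using fpos[OF \<open>i \<le> k\<close>, of "x - z"] fnn[of i "x - z"] by linarith
        then show ?thesis by simp
      qed
      then show "norm (case p of (i, z) \<Rightarrow> (f i (x - z) / D x) *\<^sub>R (x - z))
          \<le> (case p of (i, z) \<Rightarrow> f i (x - z) / D x * r)"
        using Dpos[OF that] by (simp add: p)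
    qed
    also have "\<dots> = r"
      using arg_cong[OF 1, of "\<lambda>s. s * r"] by (simp add: case_prod_unfold sum_distrib_right)
    finally show ?thesis .
  qed
  have surj: "cball 0 1 \<subseteq> F ` B"
  proof
    fix y :: "real ^ 'n" assume y: "y \<in> cball 0 1"
    have "y + (x - F x) \<in> cball 0 (r + 1)" if "x \<in> cball 0 (r + 1)" for x
      using F_dist[of x] that y norm_triangle_ineq[of y "x - F x"] by (simp add: B_def)
    moreover have "0 < r + 1" by (simp add: r_def)
    ultimately have "\<exists>x\<in>cball 0 (r + 1). F x = y"
      using contF by (intro brouwer_surjective_cball[of 0 "r + 1" F y "{y}"]) (auto simp: B_def)
    then show "y \<in> F ` B" by (auto simp: B_def)
  qed
  define T where "T = ({..k} \<rightarrow>\<^sub>E Z)"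
  have "F ` B \<subseteq> (\<Union>\<zeta>\<in>T. convex hull (\<zeta> ` {..k}))"
  proof
    fix y assume "y \<in> F ` B"
    then obtain x where x: "x \<in> B" "y = F x" by blast
    define \<zeta> where "\<zeta> = restrict (\<lambda>i. if \<exists>z\<in>Z. x - z \<in> W i then SOME z. z \<in> Z \<and> x - z \<in> W i else 0) {..k}"
    have \<zeta>: "\<zeta> i \<in> Z \<and> x - \<zeta> i \<in> W i" if "i \<le> k" "z \<in> Z" "x - z \<in> W i" for i z
      using that someI[of "\<lambda>z. z \<in> Z \<and> x - z \<in> W i" z] by (auto simp: \<zeta>_def)
    have "0 \<in> Z" by (simp add: Z_def r_def)
    then have "\<zeta> i \<in> Z" if "i \<le> k" for i
      using \<zeta>[OF that] that by (cases "\<exists>z\<in>Z. x - z \<in> W i") (auto simp: \<zeta>_def)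
    then have "\<zeta> \<in> T"
      by (auto simp: T_def \<zeta>_def)
    moreover have "F x \<in> convex hull (\<zeta> ` {..k})"
    proof -
      define c where "c p = f (fst p) (x - snd p) / D x" for p :: "nat \<times> (real ^ 'n)"
      define N' where "N' = {p \<in> N. c p \<noteq> 0}"
      have c: "c p \<ge> 0" for p using fnn Dpos[OF x(1)] by (simp add: c_def)
      have N': "finite N'" "N' \<subseteq> N" "\<forall>p\<in>N - N'. c p = 0" using finN by (auto simp: N'_def)
      have "(\<Sum>p\<in>N. c p) = 1"
        using Dpos[OF x(1)] by (simp add: case_prod_unfold D_def c_def flip: sum_divide_distrib)
      then have 1: "(\<Sum>p\<in>N'. c p) = 1"
        using sum.mono_neutral_left[OF finN N'(2,3)] by simp
      have 2: "F x = (\<Sum>p\<in>N'. c p *\<^sub>R snd p)"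
        unfolding F_def case_prod_unfold c_def[symmetric]
        using N' by (intro sum.mono_neutral_right finN) auto
      have 3: "snd p \<in> convex hull (\<zeta> ` {..k})" if p: "p \<in> N'" for p
      proof -
        have ik: "fst p \<le> k" "snd p \<in> Z" using p by (auto simp: N'_def N_def)
        have "f (fst p) (x - snd p) > 0"
          using p fnn[of "fst p" "x - snd p"] by (simp add: N'_def c_def)
        then have W: "x - snd p \<in> W (fst p)" using fpos ik by blast
        then have "snd p = \<zeta> (fst p)"
          using \<zeta>[OF ik(1,2) W] ik dis[OF ik(1)] by (auto simp: Z_def W_def)
        then show ?thesis using ik by (auto intro!: hull_inc)
      qed
      show ?thesis unfolding 2
        by (rule convex_sum[OF N'(1) convex_convex_hull 1]) (use c 3 in auto)
    qed
    ultimately show "y \<in> (\<Union>\<zeta>\<in>T. convex hull (\<zeta> ` {..k}))" using x by blast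
  qed
  moreover have "negligible (\<Union>\<zeta>\<in>T. convex hull (\<zeta> ` {..k}))"
  proof (intro negligible_Union ballI; clarify?)
    show "finite ((\<lambda>\<zeta>. convex hull (\<zeta> ` {..k})) ` T)"
      by (simp add: T_def finZ finite_PiE)
    fix \<zeta> :: "nat \<Rightarrow> real ^ 'n"
    have "card (\<zeta> ` {..k}) \<le> card {..k}" by (rule card_image_le) simp
    with k show "negligible (convex hull (\<zeta> ` {..k}))"
      by (intro negligible_convex_hull_finite) auto
  qed
  ultimately have "negligible (cball 0 1 :: (real ^ 'n) set)"
    using surj by (meson negligible_subset order.trans)
  then show False
    using negligible_convex_interior[of "cball 0 1 :: (real ^ 'n) set"] by auto
qed

text \<open>This extends the labels from the sets \<open>P i\<close>, which may be arbitrary, to open sets. The balls around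
  points labelled \<open>0\<close> whose doubles meet only points labelled \<open>0\<close> have disjoint translates, since two
  intersecting balls lie in the double of the larger one.\<close>
lemma equivariant_labels_imp_card:
  fixes P :: "nat \<Rightarrow> (real ^ 'n) set" and \<kappa> :: "nat \<Rightarrow> real ^ 'n \<Rightarrow> real ^ 'n"
  assumes cov: "(\<Union>i\<le>k. P i) = UNIV"
    and inv: "\<And>i x z. \<lbrakk>i \<le> k; x \<in> P i; z \<in> lattice\<rbrakk> \<Longrightarrow> x + z \<in> P i"
    and cont: "\<And>i. i \<le> k \<Longrightarrow> continuous_on (P i) (\<kappa> i)"
    and lat: "\<And>i x. \<lbrakk>i \<le> k; x \<in> P i\<rbrakk> \<Longrightarrow> \<kappa> i x \<in> lattice"
    and eqv: "\<And>i x z. \<lbrakk>i \<le> k; x \<in> P i; z \<in> lattice\<rbrakk> \<Longrightarrow> \<kappa> i (x + z) = \<kappa> i x + z"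
  shows "CARD('n) \<le> k"
proof -
  define P0 where "P0 i = {x \<in> P i. \<kappa> i x = 0}" for i
  define V where "V i = \<Union>{ball a r | a r. a \<in> P0 i \<and> 0 < r \<and> ball a (2 * r) \<inter> P i \<subseteq> P0 i}" for i
  show ?thesis
  proof (rule lattice_translates_cover_imp_card[of k V])
    show "open (V i)" for i by (auto simp: V_def)
  next
    fix x
    obtain i where i: "i \<le> k" "x \<in> P i" using cov by blast
    define z where "z = \<kappa> i x"
    have z: "z \<in> lattice" using lat i by (simp add: z_def)
    have a: "x - z \<in> P0 i"
      using inv[OF i lattice_minus[OF z]] eqv[OF i lattice_minus[OF z]] by (simp add: P0_def z_def)
    then have "x - z \<in> P i" by (simp add: P0_def)
    then obtain d where d: "d > 0" "\<forall>y\<in>P i. dist y (x - z) < d \<longrightarrow> dist (\<kappa> i y) (\<kappa> i (x - z)) < 1"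
      using cont[OF i(1)] unfolding continuous_on_iff by (metis zero_less_one)
    have "ball (x - z) (2 * (d / 2)) \<inter> P i \<subseteq> P0 i"
    proof
      fix y assume y: "y \<in> ball (x - z) (2 * (d / 2)) \<inter> P i"
      then have "dist (\<kappa> i y) 0 < 1" using d a by (auto simp: P0_def dist_commute)
      then have "\<kappa> i y = 0" using lattice_dist_ge_1[of "\<kappa> i y" 0] lat[OF i(1)] y by force
      then show "y \<in> P0 i" using y by (simp add: P0_def)
    qed
    then have "x - z \<in> V i"
      using a d(1) unfolding V_def by (intro UnionI[of "ball (x - z) (d / 2)"]) (auto intro!: exI[of _ "x - z"] exI[of _ "d/2"])
    then show "\<exists>i\<le>k. \<exists>z\<in>lattice. x - z \<in> V i" using i z by blast
  next
    fix i x z w assume i: "i \<le> k" and zw: "z \<in> lattice" "w \<in> lattice" and V: "x - z \<in> V i" "x - w \<in> V i"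
    have key: "z = w" if "a \<in> P0 i" "b \<in> P0 i" "ball a (2 * r) \<inter> P i \<subseteq> P0 i" "x - z \<in> ball a r"
      "x - w \<in> ball b r'" "r' \<le> r" "z \<in> lattice" "w \<in> lattice" for a b r r' z w
    proof -
      have b: "b + (w - z) \<in> P i" "\<kappa> i (b + (w - z)) = w - z"
        using that i inv[of i b "w - z"] eqv[of i b "w - z"] by (auto simp: P0_def lattice_diff)
      have "dist a (b + (w - z)) = norm ((a - (x - z)) + ((x - w) - b))"
        by (simp add: dist_norm algebra_simps)
      also have "\<dots> \<le> dist a (x - z) + dist (x - w) b"
        unfolding dist_norm by (rule norm_triangle_ineq)
      also have "\<dots> < 2 * r" using that by (simp add: dist_commute)
      finally have "b + (w - z) \<in> P0 i" using that b by auto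
      then show ?thesis using b by (simp add: P0_def)
    qed
    have Vball: "\<exists>a r. a \<in> P0 i \<and> ball a (2 * r) \<inter> P i \<subseteq> P0 i \<and> y \<in> ball a r" if "y \<in> V i" for y
    proof -
      obtain a r where "y \<in> ball a r" "a \<in> P0 i" "ball a (2 * r) \<inter> P i \<subseteq> P0 i"
        using \<open>y \<in> V i\<close> unfolding V_def by (elim UnionE CollectE exE conjE) simp
      then show ?thesis by (intro exI[of _ a] exI[of _ r]) simp
    qed
    obtain a r where "a \<in> P0 i" "ball a (2 * r) \<inter> P i \<subseteq> P0 i" "x - z \<in> ball a r"
      using Vball[OF V(1)] by blast
    moreover obtain b r' where "b \<in> P0 i" "ball b (2 * r') \<inter> P i \<subseteq> P0 i" "x - w \<in> ball b r'"
      using Vball[OF V(2)] by blast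
    ultimately show "z = w" using key[of a b r z w r'] key[of b a r' w z r] zw by (cases "r' \<le> r") auto
  qed
qed

section \<open>Path spaces and the comparison of the two invariants\<close>

text \<open>One direction of the exponential law: the tube lemma, applied to the compact sets that define the
  topology, turns a neighbourhood of a slice into a neighbourhood of the parameter.\<close>
lemma continuous_map_compact_open_curry:
  assumes f: "continuous_map (prod_topology Z X) W (\<lambda>(z, t). f z t)"
    and ext: "\<And>z. z \<in> topspace Z \<Longrightarrow> f z \<in> extensional (topspace X)"
  shows "continuous_map Z (compact_open_topology X W) f"
proof -
  have mem: "f z \<in> map_set X W" if z: "z \<in> topspace Z" for z
  proof -
    have "continuous_map X (prod_topology Z X) (\<lambda>t. (z, t))"
      using z by (simp add: continuous_map_paired)
    from continuous_map_compose[OF this f] show ?thesis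
      using ext[OF z] by (simp add: map_set_def o_def)
  qed
  have "openin Z (f -` {g \<in> map_set X W. g ` K \<subseteq> U} \<inter> topspace Z)"
    if K: "compactin X K" and U: "openin W U" for K U
  proof (subst openin_subopen, intro ballI)
    fix z assume z: "z \<in> f -` {g \<in> map_set X W. g ` K \<subseteq> U} \<inter> topspace Z"
    define G where "G = {p \<in> topspace (prod_topology Z X). (\<lambda>(z, t). f z t) p \<in> U}"
    have G1: "openin (prod_topology Z X) G"
      unfolding G_def by (rule openin_continuous_map_preimage[OF f U])
    have G2: "{z} \<times> K \<subseteq> G"
      using z compactin_subset_topspace[OF K] by (auto simp: G_def)
    obtain V V' where V: "openin Z V" "{z} \<subseteq> V" "K \<subseteq> V'" "V \<times> V' \<subseteq> G"
      by (rule Wallace_theorem_prod_topology[of Z "{z}" X K G]) (use K z G1 G2 in auto)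
    have "V \<subseteq> f -` {g \<in> map_set X W. g ` K \<subseteq> U} \<inter> topspace Z"
    proof (rule subsetI)
      fix y assume y: "y \<in> V"
      then have "y \<in> topspace Z" "f y \<in> map_set X W"
        using mem openin_subset[OF V(1)] by auto
      have "(y, t) \<in> G" if "t \<in> K" for t using V(3,4) y that by blast
      then have "f y ` K \<subseteq> U" by (auto simp: G_def)
      with \<open>y \<in> topspace Z\<close> \<open>f y \<in> map_set X W\<close> show "y \<in> f -` {g \<in> map_set X W. g ` K \<subseteq> U} \<inter> topspace Z" by simp
    qed
    then show "\<exists>T. openin Z T \<and> z \<in> T \<and> T \<subseteq> f -` {g \<in> map_set X W. g ` K \<subseteq> U} \<inter> topspace Z"
      using V by blast
  qed
  moreover have "f ` topspace Z \<subseteq> topspace (compact_open_topology X W)"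
    using mem by auto
  ultimately show ?thesis
    unfolding compact_open_topology_def continuous_on_generated_topo_iff
    by (auto simp: topology_generated_by_topspace)
qed

text \<open>The other direction: evaluation is continuous because each point of \<open>X\<close> has a small compact
  neighbourhood, to which the definition of the topology can be applied.\<close>
lemma continuous_map_compact_open_uncurry:
  assumes X: "neighbourhood_base_of (compactin X) X"
    and f: "continuous_map Z (compact_open_topology X W) f"
  shows "continuous_map (prod_topology Z X) W (\<lambda>(z, t). f z t)"
proof -
  have mem: "f z \<in> map_set X W" if z: "z \<in> topspace Z" for z
    using continuous_map_image_subset_topspace[OF f] that by auto
  show ?thesis
    unfolding continuous_map_def
  proof (intro conjI allI impI)
    show "(\<lambda>(z, t). f z t) \<in> topspace (prod_topology Z X) \<rightarrow> topspace W"
      using mem by (auto simp: map_set_def continuous_map_def)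
    fix U assume U: "openin W U"
    show "openin (prod_topology Z X) {p \<in> topspace (prod_topology Z X). (\<lambda>(z, t). f z t) p \<in> U}"
    proof (subst openin_subopen, intro ballI)
      fix p assume "p \<in> {p \<in> topspace (prod_topology Z X). (\<lambda>(z, t). f z t) p \<in> U}"
      then obtain z t where p: "p = (z, t)" "z \<in> topspace Z" "t \<in> topspace X" "f z t \<in> U" by auto
      have "openin X {t \<in> topspace X. f z t \<in> U}"
        using mem[OF p(2)] U by (auto simp: map_set_def continuous_map_def)
      then obtain N K where N: "openin X N" "compactin X K" "t \<in> N" "N \<subseteq> K" "K \<subseteq> {t \<in> topspace X. f z t \<in> U}"
        using X[unfolded neighbourhood_base_of, rule_format, of "{t \<in> topspace X. f z t \<in> U}" t] p by auto
      define V where "V = {y \<in> topspace Z. f y \<in> {g \<in> map_set X W. g ` K \<subseteq> U}}"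
      have "openin (compact_open_topology X W) {g \<in> map_set X W. g ` K \<subseteq> U}"
        unfolding compact_open_topology_def using N(2) U by (intro topology_generated_by_Basis) blast
      then have "openin Z V"
        unfolding V_def by (rule openin_continuous_map_preimage[OF f])
      moreover have "z \<in> V" using mem p N by (auto simp: V_def)
      moreover have "V \<times> N \<subseteq> {p \<in> topspace (prod_topology Z X). (\<lambda>(z, t). f z t) p \<in> U}"
      proof clarify
        fix y u assume "y \<in> V" "u \<in> N"
        moreover have "u \<in> K" "u \<in> topspace X" using \<open>u \<in> N\<close> N(4) openin_subset[OF N(1)] by auto
        ultimately show "(y, u) \<in> topspace (prod_topology Z X) \<and> f y u \<in> U" by (auto simp: V_def)
      qed
      ultimately show "\<exists>T. openin (prod_topology Z X) T \<and> p \<in> T \<and>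
          T \<subseteq> {p \<in> topspace (prod_topology Z X). (\<lambda>(z, t). f z t) p \<in> U}"
        using N p by (intro exI[of _ "V \<times> N"]) (auto simp: openin_prod_Times_iff)
    qed
  qed
qed

lemma neighbourhood_base_unit_interval: "neighbourhood_base_of (compactin unit_interval) unit_interval"
proof -
  have "compact_space unit_interval"
    by (simp add: compact_space_subtopology)
  then have "locally_compact_space unit_interval" by (rule compact_imp_locally_compact_space)
  moreover have "Hausdorff_space unit_interval" by (simp add: Hausdorff_space_subtopology)
  ultimately show ?thesis using locally_compact_space_neighbourhood_base by blast
qed

text \<open>Reduces continuity into path spaces, also iterated ones, to continuity of functions of several
  variables.\<close>
lemma continuous_map_path_space_iff:
  "continuous_map Z (path_space W) f \<longleftrightarrow>
     continuous_map (prod_topology Z unit_interval) W (\<lambda>(z, t). f z t) \<and>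
     (\<forall>z\<in>topspace Z. f z \<in> extensional {0..1})" (is "?L \<longleftrightarrow> ?R")
proof
  assume L: ?L
  then have "f z \<in> map_set unit_interval W" if "z \<in> topspace Z" for z
    using continuous_map_image_subset_topspace[OF L] that by (auto simp: path_space_def)
  with L show ?R
    using continuous_map_compact_open_uncurry[OF neighbourhood_base_unit_interval]
    by (auto simp: path_space_def map_set_def)
next
  assume ?R then show ?L
    unfolding path_space_def by (intro continuous_map_compact_open_curry) auto
qed

lemma topspace_path_space_between:
  "topspace (path_space_between Z z0 z1) =
     {\<gamma>. continuous_map unit_interval Z \<gamma> \<and> \<gamma> \<in> extensional {0..1} \<and> \<gamma> 0 = z0 \<and> \<gamma> 1 = z1}"
  by (auto simp: path_space_between_def path_space_def map_set_def)

definition path_section :: "'a topology \<Rightarrow> ('a \<times> 'a) set \<Rightarrow> ('a \<times> 'a \<Rightarrow> real \<Rightarrow> 'a) \<Rightarrow> bool" where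
  "path_section Z E s \<longleftrightarrow>
     continuous_map (subtopology (prod_topology Z Z) E) (path_space Z) s \<and>
        (\<forall>(z0, z1) \<in> E. s (z0, z1) \<in> topspace (path_space_between Z z0 z1))"

lemma homeomorphic_map_to_mcompletion:
  "homeomorphic_map (mtopology_of X)
     (subtopology (mtopology_of (mcompletion X)) (to_mcompletion X ` mspace X)) (to_mcompletion X)"
proof -
  let ?i = "to_mcompletion X" and ?Y = "mcompletion X"
  have i: "?i \<in> mspace X \<rightarrow> mspace ?Y" "\<And>x y. x \<in> mspace X \<Longrightarrow> y \<in> mspace X \<Longrightarrow> mdist ?Y (?i x) (?i y) = mdist X x y"
    using is_completion_mcompletion[of X] by (auto simp: is_completion_def)
  then have sub: "?i ` mspace X \<subseteq> mspace ?Y" by auto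
  interpret Metric_space12 "mspace X" "mdist X" "mspace ?Y" "mdist ?Y"
    by (simp add: Metric_space12_def)
  show ?thesis
    using isometry_imp_embedding_map[of ?i] i sub
    by (simp add: embedding_map_def mtopology_of_def image_subset_iff_funcset)
qed

text \<open>At parameter \<open>1\<close> the near-geodesics run in the copy of \<open>X\<close> inside the completion, from where they can be
  pulled back to \<open>X\<close>.\<close>
lemma ngmpr_imp_path_section:
  assumes ng: "ngmpr X E \<Phi>" and E: "E \<subseteq> mspace X \<times> mspace X"
  shows "\<exists>s. path_section (mtopology_of X) E s"
proof -
  define Y where "Y = mcompletion X"
  define i where "i = to_mcompletion X"
  define T where "T = subtopology (prod_topology (mtopology_of X) (mtopology_of X)) E"
  let ?X' = "subtopology (mtopology_of Y) (i ` mspace X)"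
  have topT: "topspace T = E" using E by (auto simp: T_def)
  have \<Phi>: "continuous_map T (path_space (path_space (mtopology_of Y))) \<Phi>"
    and near: "\<And>x0 x1. (x0, x1) \<in> E \<Longrightarrow>
      near_geodesic Y (submetric Y (i ` mspace X)) (i x0) (i x1) (\<Phi> (x0, x1))"
    using ng by (auto simp: ngmpr_def Let_def Y_def i_def T_def path_space_def)
  have "continuous_map (prod_topology T unit_interval) (path_space (mtopology_of Y)) (\<lambda>(z, t). \<Phi> z t)"
    using \<Phi> continuous_map_path_space_iff by blast
  moreover have "continuous_map T (prod_topology T unit_interval) (\<lambda>z. (z, 1))"
    by (simp add: continuous_map_paired)
  ultimately have \<Phi>1: "continuous_map T (path_space (mtopology_of Y)) (\<lambda>z. \<Phi> z 1)"
    using continuous_map_compose[of T "prod_topology T unit_interval" "\<lambda>z. (z, 1)"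
        "path_space (mtopology_of Y)" "\<lambda>(z, t). \<Phi> z t"] by (simp add: o_def)
  have mem: "\<Phi> (x0, x1) 1 \<in> topspace (path_space_between ?X' (i x0) (i x1))" if "(x0, x1) \<in> E" for x0 x1
    using near[OF that] by (auto simp: near_geodesic_def mtopology_of_submetric)
  obtain j where j: "homeomorphic_maps (mtopology_of X) ?X' i j"
    using homeomorphic_map_to_mcompletion[of X] unfolding homeomorphic_map_maps Y_def i_def by blast
  have ji: "j (i x) = x" if "x \<in> mspace X" for x
    using j that by (simp add: homeomorphic_maps_def)
  define s where "s z = restrict (\<lambda>t. j (\<Phi> z 1 t)) {0..1}" for z
  have "continuous_map (prod_topology T unit_interval) ?X' (\<lambda>(z, t). \<Phi> z 1 t)"
  proof (rule continuous_map_into_subtopology)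
    show "continuous_map (prod_topology T unit_interval) (mtopology_of Y) (\<lambda>(z, t). \<Phi> z 1 t)"
      using \<Phi>1 unfolding continuous_map_path_space_iff by blast
    show "(\<lambda>(z, t). \<Phi> z 1 t) \<in> topspace (prod_topology T unit_interval) \<rightarrow> i ` mspace X"
    proof clarify
      fix a b t assume *: "((a, b), t) \<in> topspace (prod_topology T unit_interval)"
      then have "continuous_map unit_interval ?X' (\<Phi> (a, b) 1)"
        using mem[of a b] by (simp add: topT topspace_path_space_between)
      then have "\<Phi> (a, b) 1 t \<in> topspace ?X'"
        using * by (intro continuous_map_image_subset_topspace[THEN subsetD]) auto
      then show "\<Phi> (a, b) 1 t \<in> i ` mspace X" by simp
    qed
  qed
  then have "continuous_map (prod_topology T unit_interval) (mtopology_of X) (j \<circ> (\<lambda>(z, t). \<Phi> z 1 t))"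
    using j continuous_map_compose[of _ ?X' "\<lambda>(z, t). \<Phi> z 1 t"] unfolding homeomorphic_maps_def by blast
  then have "continuous_map (prod_topology T unit_interval) (mtopology_of X) (\<lambda>(z, t). s z t)"
    by (rule continuous_map_eq) (auto simp: s_def)
  then have "continuous_map T (path_space (mtopology_of X)) s"
    by (auto simp: continuous_map_path_space_iff s_def)
  moreover have "s (x0, x1) \<in> topspace (path_space_between (mtopology_of X) x0 x1)" if "(x0, x1) \<in> E" for x0 x1
  proof -
    have "continuous_map unit_interval ?X' (\<Phi> (x0, x1) 1)" "\<Phi> (x0, x1) 1 0 = i x0" "\<Phi> (x0, x1) 1 1 = i x1"
      using mem[OF that] by (auto simp: topspace_path_space_between)
    then have "continuous_map unit_interval (mtopology_of X) (j \<circ> \<Phi> (x0, x1) 1)"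
      using j continuous_map_compose[of _ ?X' "\<Phi> (x0, x1) 1"] unfolding homeomorphic_maps_def by blast
    then have "continuous_map unit_interval (mtopology_of X) (s (x0, x1))"
      by (rule continuous_map_eq) (auto simp: s_def)
    moreover have "x0 \<in> mspace X" "x1 \<in> mspace X" using that E by auto
    then have "s (x0, x1) 0 = x0" "s (x0, x1) 1 = x1"
      using ji \<open>\<Phi> (x0, x1) 1 0 = i x0\<close> \<open>\<Phi> (x0, x1) 1 1 = i x1\<close> by (simp_all add: s_def)
    ultimately show ?thesis
      by (simp add: topspace_path_space_between s_def)
  qed
  ultimately have "path_section (mtopology_of X) E s"
    unfolding path_section_def T_def by blast
  then show ?thesis by blast
qed

lemma TC_eq_path_section:
  "TC Z = Inf {enat k | k. \<exists>E. lc_partition Z k E \<and> (\<forall>i\<le>k. \<exists>s. path_section Z (E i) s)}"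
  unfolding TC_def path_section_def by (rule refl)

lemma TC_le_GC: "TC (mtopology_of X) \<le> GC X"
  unfolding TC_eq_path_section GC_def
proof (rule Inf_superset_mono, rule subsetI)
  fix e assume "e \<in> {enat k | k. \<exists>E. lc_partition (mtopology_of X) k E \<and> (\<forall>i\<le>k. \<exists>\<Phi>. ngmpr X (E i) \<Phi>)}"
  then obtain k E where e: "e = enat k" and lc: "lc_partition (mtopology_of X) k E"
    and ng: "\<And>i. i \<le> k \<Longrightarrow> \<exists>\<Phi>. ngmpr X (E i) \<Phi>"
    by auto
  have "\<exists>s. path_section (mtopology_of X) (E i) s" if i: "i \<le> k" for i
  proof -
    have "E i \<subseteq> mspace X \<times> mspace X"
      using lc i by (auto simp: lc_partition_def)
    then show ?thesis
      using ng[OF i] ngmpr_imp_path_section by blast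
  qed
  with e lc show "e \<in> {enat k | k. \<exists>E. lc_partition (mtopology_of X) k E \<and>
      (\<forall>i\<le>k. \<exists>s. path_section (mtopology_of X) (E i) s)}"
    by auto
qed

section \<open>The configuration space as a quotient of ordered configurations\<close>

lemma open_map_prod:
  assumes f: "open_map X X' f" and g: "open_map Y Y' g"
  shows "open_map (prod_topology X Y) (prod_topology X' Y') (\<lambda>(x, y). (f x, g y))"
  unfolding open_map_def
proof (intro allI impI)
  fix U assume U: "openin (prod_topology X Y) U"
  show "openin (prod_topology X' Y') ((\<lambda>(x, y). (f x, g y)) ` U)"
    unfolding openin_prod_topology_alt
  proof (intro allI impI)
    fix a b assume "(a, b) \<in> (\<lambda>(x, y). (f x, g y)) ` U"
    then obtain x y where xy: "(x, y) \<in> U" "a = f x" "b = g y" by auto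
    then obtain V W where VW: "openin X V" "openin Y W" "x \<in> V" "y \<in> W" "V \<times> W \<subseteq> U"
      using U unfolding openin_prod_topology_alt by metis
    show "\<exists>U' V'. openin X' U' \<and> openin Y' V' \<and> a \<in> U' \<and> b \<in> V' \<and>
        U' \<times> V' \<subseteq> (\<lambda>(x, y). (f x, g y)) ` U"
    proof (intro exI conjI)
      show "openin X' (f ` V)" "openin Y' (g ` W)"
        using VW f g by (auto simp: open_map_def)
      show "a \<in> f ` V" "b \<in> g ` W" using xy VW by auto
      show "f ` V \<times> g ` W \<subseteq> (\<lambda>(x, y). (f x, g y)) ` U"
      proof clarify
        fix v w assume "v \<in> V" "w \<in> W"
        then have "(v, w) \<in> U" using VW by auto
        then show "(f v, g w) \<in> (\<lambda>(x, y). (f x, g y)) ` U" by (rule rev_image_eqI) simp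
      qed
    qed
  qed
qed

definition ordered_conf :: "(complex \<times> complex) set" where
  "ordered_conf = {(a, a'). a \<noteq> 0 \<and> a' \<noteq> 0 \<and> a \<noteq> a'}"

lemma open_ordered_conf: "open ordered_conf"
proof -
  have "ordered_conf = {p. fst p \<noteq> 0} \<inter> {p. snd p \<noteq> 0} \<inter> {p. fst p \<noteq> snd p}"
    by (auto simp: ordered_conf_def)
  also have "open \<dots>"
    by (intro open_Int open_Collect_neq continuous_intros)
  finally show ?thesis .
qed

lemma closure_ordered_conf: "closure ordered_conf = UNIV"
proof -
  have "\<exists>q\<in>ordered_conf. dist q p < e" if e: "e > 0" for p e
  proof -
    obtain a a' where p: "p = (a, a')" by (cases p)
    have "infinite {0<..<e / 3}" using e by simp
    then have inf: "infinite ({0<..<e / 3} - {- Re a, - Re a' / 2, Re a - Re a'})"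
      by (intro Diff_infinite_finite) auto
    obtain t where t: "t \<in> {0<..<e / 3} - {- Re a, - Re a' / 2, Re a - Re a'}"
      using infinite_imp_nonempty[OF inf] unfolding ex_in_conv[symmetric] by (rule exE)
    let ?q = "(a + of_real t, a' + of_real (2 * t))"
    have "dist ?q p \<le> dist (a + of_real t) a + dist (a' + of_real (2 * t)) a'"
      unfolding p dist_Pair_Pair by (rule sqrt_sum_squares_le_sum) auto
    also have "\<dots> = 3 * t" using t by (simp add: dist_norm norm_mult)
    also have "\<dots> < e" using t by simp
    finally have "dist ?q p < e" .
    moreover have "?q \<in> ordered_conf"
      using t by (auto simp: ordered_conf_def complex_eq_iff)
    ultimately show ?thesis by blast
  qed
  then show ?thesis by (auto simp: closure_approachable)
qed

context
  fixes x0 :: "real ^ 2"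
begin

text \<open>An isometry from the complex plane onto the plane that takes \<open>0\<close> to the puncture.\<close>
definition place :: "complex \<Rightarrow> real ^ 2" where
  "place z = x0 + vector [Re z, Im z]"

lemma dist_place [simp]: "dist (place z) (place w) = dist z w"
  by (simp add: place_def dist_norm norm_vec_def L2_set_def sum_2 cmod_def)

lemma place_eq_iff [simp]: "place z = place w \<longleftrightarrow> z = w"
  by (metis dist_eq_0_iff dist_place)

lemma place_0: "place 0 = x0"
  by (simp add: place_def vec_eq_iff forall_2)

lemma surj_place: "surj place"
proof (rule surjI)
  fix v :: "real ^ 2"
  show "place (Complex ((v - x0) $ 1) ((v - x0) $ 2)) = v"
    by (simp add: place_def vec_eq_iff forall_2)
qed

definition unordered :: "complex \<times> complex \<Rightarrow> (real ^ 2) set" where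
  "unordered p = {place (fst p), place (snd p)}"

abbreviation conf_metric :: "(real ^ 2) set metric" where "conf_metric \<equiv> conf2_metric (UNIV - {x0})"

lemma unordered_swap [simp]: "unordered (prod.swap p) = unordered p"
  by (auto simp: unordered_def)

lemma unordered_eq_iff: "unordered p = unordered q \<longleftrightarrow> p = q \<or> p = prod.swap q"
  by (auto simp: unordered_def doubleton_eq_iff prod_eq_iff)

lemma unordered_image: "unordered ` ordered_conf = mspace conf_metric"
proof (rule set_eqI, rule iffI)
  fix A assume "A \<in> unordered ` ordered_conf"
  then obtain p where p: "p \<in> ordered_conf" "A = unordered p" by (rule imageE)
  define a b where "a = fst p" and "b = snd p"
  have ab: "a \<noteq> 0" "b \<noteq> 0" "a \<noteq> b" "A = {place a, place b}"
    using p by (simp_all add: unordered_def ordered_conf_def a_def b_def case_prod_unfold)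
  then have "place a \<noteq> x0" "place b \<noteq> x0" "place a \<noteq> place b"
    using place_eq_iff[of a 0] place_eq_iff[of b 0] by (simp_all add: place_0)
  then show "A \<in> mspace conf_metric" unfolding ab(4) by (simp add: conf2_def)
next
  fix A assume "A \<in> mspace conf_metric"
  then have "A \<in> conf2 (UNIV - {x0})" by simp
  then obtain v w where A: "A = {v, w}" "v \<noteq> w" "v \<in> UNIV - {x0}" "w \<in> UNIV - {x0}"
    by (rule conf2_cases)
  obtain a where "v = place a" using surj_place by (rule surjE)
  moreover obtain b where "w = place b" using surj_place by (rule surjE)
  ultimately have "(a, b) \<in> ordered_conf" "A = unordered (a, b)"
    using place_0 A by (auto simp: ordered_conf_def unordered_def)
  then show "A \<in> unordered ` ordered_conf" by blast
qed

lemma mdist_unordered: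
  assumes "p \<in> ordered_conf" "q \<in> ordered_conf"
  shows "mdist conf_metric (unordered p) (unordered q) = min (dist p q) (dist p (prod.swap q))"
proof -
  have "unordered p \<in> conf2 (UNIV - {x0})" "unordered q \<in> conf2 (UNIV - {x0})"
    using assms unordered_image by auto
  then show ?thesis
    by (simp add: mdist_conf2_metric) (simp add: unordered_def conf2_dist_eq dist_prod_def)
qed

lemma continuous_map_unordered: "continuous_map (top_of_set ordered_conf) (mtopology_of conf_metric) unordered"
proof -
  have "Lipschitz_continuous_map (submetric euclidean_metric ordered_conf) conf_metric unordered"
    unfolding Lipschitz_continuous_map_def
    using unordered_image by (auto intro!: exI[of _ 1] simp: mdist_unordered image_subset_iff)
  from Lipschitz_continuous_imp_continuous_map[OF this] show ?thesis
    by (simp add: mtopology_of_submetric)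
qed

text \<open>A point close to \<open>{a, a'}\<close> can be ordered so that it is close to \<open>(a, a')\<close>: this is what the minimum in
  the metric says.\<close>
lemma open_map_unordered: "open_map (top_of_set ordered_conf) (mtopology_of conf_metric) unordered"
  unfolding open_map_def
proof (intro allI impI)
  fix U assume "openin (top_of_set ordered_conf) U"
  then have U: "open U" "U \<subseteq> ordered_conf"
    using open_ordered_conf by (auto simp: openin_open_eq)
  interpret Met: Metric_space "mspace conf_metric" "mdist conf_metric" by (rule Metric_space_mspace_mdist)
  have "\<exists>r>0. Met.mball A r \<subseteq> unordered ` U" if "A \<in> unordered ` U" for A
  proof -
    obtain p where p: "p \<in> U" "A = unordered p" using \<open>A \<in> unordered ` U\<close> by blast
    obtain r where r: "r > 0" "ball p r \<subseteq> U" using U(1) p open_contains_ball by blast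
    have "Met.mball A r \<subseteq> unordered ` U"
    proof
      fix B assume B: "B \<in> Met.mball A r"
      then have "B \<in> mspace conf_metric" and Br: "mdist conf_metric A B < r"
        unfolding Met.in_mball by blast+
      then obtain q where q: "q \<in> ordered_conf" "B = unordered q" using unordered_image by blast
      have "p \<in> ordered_conf" using p U by blast
      then have "min (dist p q) (dist p (prod.swap q)) < r"
        using Br p(2) q mdist_unordered by simp
      then have "q \<in> U \<or> prod.swap q \<in> U" using r by (auto simp: min_less_iff_disj)
      then show "B \<in> unordered ` U" using q unordered_swap[of q] by (metis image_eqI)
    qed
    with r show ?thesis by blast
  qed
  moreover have "unordered ` U \<subseteq> mspace conf_metric" using U unordered_image by blast
  ultimately show "openin (mtopology_of conf_metric) (unordered ` U)"
    unfolding mtopology_of_def Met.openin_mtopology by blast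
qed

definition unordered_pair :: "(complex \<times> complex) \<times> (complex \<times> complex) \<Rightarrow> (real ^ 2) set \<times> (real ^ 2) set" where
  "unordered_pair = (\<lambda>(p, q). (unordered p, unordered q))"

abbreviation pair_topology :: "((real ^ 2) set \<times> (real ^ 2) set) topology" where
  "pair_topology \<equiv> prod_topology (mtopology_of conf_metric) (mtopology_of conf_metric)"

lemma continuous_map_unordered_pair: "continuous_map (top_of_set (ordered_conf \<times> ordered_conf)) pair_topology unordered_pair"
  using continuous_map_unordered unfolding unordered_pair_def prod_topology_subtopology_eu[symmetric] continuous_map_prod_top
  by simp

lemma open_map_unordered_pair: "open_map (top_of_set (ordered_conf \<times> ordered_conf)) pair_topology unordered_pair"
  using open_map_prod[OF open_map_unordered open_map_unordered] by (simp add: unordered_pair_def)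

lemma unordered_pair_image: "unordered_pair ` (ordered_conf \<times> ordered_conf) = mspace conf_metric \<times> mspace conf_metric"
  unfolding unordered_pair_def image_paired_Times unordered_image by (rule refl)

text \<open>Continuity on a set of pairs of configurations can thus be checked on ordered representatives, which
  form a subset of a Euclidean space.\<close>
lemma quotient_map_unordered_pair:
  assumes "S = {x \<in> ordered_conf \<times> ordered_conf. unordered_pair x \<in> E}" "E \<subseteq> mspace conf_metric \<times> mspace conf_metric"
  shows "quotient_map (top_of_set S) (subtopology pair_topology E) unordered_pair"
    and "open_map (top_of_set S) (subtopology pair_topology E) unordered_pair"
    and "continuous_map (top_of_set S) (subtopology pair_topology E) unordered_pair"
proof -
  have sub: "top_of_set S = subtopology (top_of_set (ordered_conf \<times> ordered_conf)) S"
    using assms(1) by (auto simp: subtopology_subtopology Int_absorb1)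
  show op: "open_map (top_of_set S) (subtopology pair_topology E) unordered_pair"
    unfolding sub by (rule open_map_restriction[OF open_map_unordered_pair]) (use assms in auto)
  show cont: "continuous_map (top_of_set S) (subtopology pair_topology E) unordered_pair"
    unfolding sub using assms(1)
    by (intro continuous_map_into_subtopology continuous_map_from_subtopology[OF continuous_map_unordered_pair]) auto
  have "E \<subseteq> unordered_pair ` S"
  proof
    fix e assume "e \<in> E"
    then obtain x where "x \<in> ordered_conf \<times> ordered_conf" "e = unordered_pair x"
      using assms(2) unordered_pair_image by blast
    then show "e \<in> unordered_pair ` S" using assms(1) \<open>e \<in> E\<close> by blast
  qed
  then have "unordered_pair ` topspace (top_of_set S) = topspace (subtopology pair_topology E)"
    using assms by auto
  then show "quotient_map (top_of_set S) (subtopology pair_topology E) unordered_pair"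
    using continuous_open_imp_quotient_map op cont by blast
qed

lemma continuous_map_lift_unordered:
  fixes f :: "complex \<times> complex \<Rightarrow> 'b::topological_space"
  assumes f: "continuous_on ordered_conf f" and sym: "\<And>p. f (prod.swap p) = f p"
  obtains h where "continuous_map (mtopology_of conf_metric) euclidean h" "\<And>p. p \<in> ordered_conf \<Longrightarrow> h (unordered p) = f p"
proof -
  define h where "h A = f (SOME p. p \<in> ordered_conf \<and> unordered p = A)" for A
  have h: "h (unordered p) = f p" if "p \<in> ordered_conf" for p
  proof -
    define q where "q = (SOME q. q \<in> ordered_conf \<and> unordered q = unordered p)"
    have "q \<in> ordered_conf \<and> unordered q = unordered p"
      unfolding q_def by (rule someI[of "\<lambda>q. q \<in> ordered_conf \<and> unordered q = unordered p" p]) (simp add: that)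
    then have "q = p \<or> q = prod.swap p" unfolding unordered_eq_iff by (rule conjunct2)
    then have "f q = f p" using sym[of p] by (elim disjE) simp_all
    then show ?thesis by (simp add: h_def q_def)
  qed
  have q: "quotient_map (top_of_set ordered_conf) (mtopology_of conf_metric) unordered"
    by (rule continuous_open_imp_quotient_map[OF continuous_map_unordered open_map_unordered]) (simp add: unordered_image)
  have "continuous_map (mtopology_of conf_metric) euclidean h"
  proof (rule continuous_compose_quotient_map[OF q])
    have "continuous_map (top_of_set ordered_conf) euclidean f" using f by simp
    then show "continuous_map (top_of_set ordered_conf) euclidean (h \<circ> unordered)"
      by (rule continuous_map_eq) (simp add: h)
  qed
  then show thesis using h by (rule that)
qed

text \<open>The canonical map from ordered configurations to the completion does not increase distances, so it
  extends to all pairs of complex numbers, coinciding points included. By density the extension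
  inherits the formula for the distance and the invariance under the swap.\<close>
lemma completion_extension:
  defines "Y \<equiv> mcompletion conf_metric" and "i \<equiv> to_mcompletion conf_metric"
  obtains e where "continuous_map euclidean (mtopology_of Y) e"
    "\<And>p. p \<in> ordered_conf \<Longrightarrow> e p = i (unordered p)"
    "\<And>p q. mdist Y (e p) (e q) = min (dist p q) (dist p (prod.swap q))"
    "\<And>p. e (prod.swap p) = e p"
proof -
  have Y: "mcomplete_of Y" "i \<in> mspace conf_metric \<rightarrow> mspace Y"
    "\<And>A B. A \<in> mspace conf_metric \<Longrightarrow> B \<in> mspace conf_metric \<Longrightarrow> mdist Y (i A) (i B) = mdist conf_metric A B"
    using is_completion_mcompletion[of conf_metric] unfolding is_completion_def Y_def i_def by (simp_all only: simp_thms)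
  have inM: "unordered p \<in> mspace conf_metric" if "p \<in> ordered_conf" for p using that unordered_image by blast
  have dF: "mdist Y (i (unordered p)) (i (unordered q)) = min (dist p q) (dist p (prod.swap q))"
    if "p \<in> ordered_conf" "q \<in> ordered_conf" for p q
    using Y(3)[OF inM inM] that mdist_unordered by simp
  have lip: "Lipschitz_continuous_map (submetric euclidean_metric ordered_conf) Y (\<lambda>p. i (unordered p))"
    unfolding Lipschitz_continuous_map_def
  proof (intro conjI exI[of _ 1] ballI)
    show "(\<lambda>p. i (unordered p)) \<in> mspace (submetric euclidean_metric ordered_conf) \<rightarrow> mspace Y"
      using Y(2) inM by auto
  qed (simp add: dF)
  obtain e where e: "Lipschitz_continuous_map (submetric euclidean_metric
      (mtopology_of euclidean_metric closure_of ordered_conf)) Y e"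
    and eF: "\<And>p. p \<in> ordered_conf \<Longrightarrow> e p = i (unordered p)"
    by (rule Lipschitz_continuous_map_extends_to_closure_of[OF Y(1) lip]) (rule that)
  have cont: "continuous_map euclidean (mtopology_of Y) e"
    using Lipschitz_continuous_imp_continuous_map[OF e] by (simp add: mtopology_of_submetric closure_ordered_conf)
  have dist: "mdist Y (e p) (e q) = min (dist p q) (dist p (prod.swap q))" for p q
  proof -
    define h where "h x = mdist Y (e (fst x)) (e (snd x)) - min (dist (fst x) (snd x)) (dist (fst x) (prod.swap (snd x)))"
      for x :: "(complex \<times> complex) \<times> (complex \<times> complex)"
    have "continuous_map (prod_topology euclidean euclidean) euclidean
        (\<lambda>x :: (complex \<times> complex) \<times> (complex \<times> complex). mdist Y (e (fst x)) (e (snd x)))"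
      by (intro continuous_map_mdist continuous_map_compose[OF continuous_map_fst cont, unfolded o_def]
          continuous_map_compose[OF continuous_map_snd cont, unfolded o_def])
    then have "continuous_on UNIV (\<lambda>x :: (complex \<times> complex) \<times> (complex \<times> complex). mdist Y (e (fst x)) (e (snd x)))"
      by simp
    then have "continuous_on UNIV h"
      unfolding h_def prod.swap_def by (intro continuous_intros)
    then have "continuous_on (closure (ordered_conf \<times> ordered_conf)) h"
      using continuous_on_subset by blast
    moreover have "h x = 0" if "x \<in> ordered_conf \<times> ordered_conf" for x
      using that dF[of "fst x" "snd x"] eF[of "fst x"] eF[of "snd x"] by (simp add: h_def mem_Times_iff)
    moreover have "(p, q) \<in> closure (ordered_conf \<times> ordered_conf)"
      by (simp add: closure_Times closure_ordered_conf)
    ultimately have "h (p, q) = 0"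
      by (rule continuous_constant_on_closure)
    then show ?thesis by (simp add: h_def)
  qed
  have sw: "e (prod.swap p) = e p" for p
  proof -
    have mem: "e q \<in> mspace Y" for q
    proof -
      have "e q \<in> topspace (mtopology_of Y)"
        by (rule subsetD[OF continuous_map_image_subset_topspace[OF cont] imageI]) (simp only: topspace_euclidean UNIV_I)
      then show ?thesis by (simp only: topspace_mtopology_of)
    qed
    have "mdist Y (e (prod.swap p)) (e p) = 0"
      unfolding dist by (simp add: min_absorb2)
    then show ?thesis
      unfolding mdist_zero[OF mem mem] .
  qed
  show thesis by (rule that[OF cont eF dist sw])
qed

end

section \<open>The lower bound\<close>

text \<open>Homotopy lifting for the exponential covering: a choice of logarithm at time \<open>0\<close> propagates along a
  family of paths that avoid \<open>0\<close>, continuously in the parameter.\<close>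
lemma log_lift:
  fixes h :: "real \<times> 'c::real_normed_vector \<Rightarrow> complex"
  assumes "continuous_on ({0..1} \<times> U) h" "\<And>t y. t \<in> {0..1} \<Longrightarrow> y \<in> U \<Longrightarrow> h (t, y) \<noteq> 0"
    and "continuous_on U f" "\<And>y. y \<in> U \<Longrightarrow> h (0, y) = exp (f y)"
  obtains k where "continuous_on ({0..1} \<times> U) k" "\<And>y. y \<in> U \<Longrightarrow> k (0, y) = f y"
    "\<And>t y. t \<in> {0..1} \<Longrightarrow> y \<in> U \<Longrightarrow> exp (k (t, y)) = h (t, y)"
proof -
  have "h \<in> {0..1} \<times> U \<rightarrow> - {0}" using assms(2) by auto
  then obtain k where k: "continuous_on ({0..1} \<times> U) k" "k \<in> {0..1} \<times> U \<rightarrow> UNIV"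
    "\<And>y. y \<in> U \<Longrightarrow> k (0, y) = f y" "\<And>z. z \<in> {0..1} \<times> U \<Longrightarrow> h z = exp (k z)"
    by (rule covering_space_lift_homotopy[OF covering_space_exp_punctured_plane assms(1) _ assms(4,3)]) auto
  show thesis
    by (rule that[OF k(1,3)]) (use k(4) in auto)
qed

lemma log_lift_unique:
  fixes f g :: "real \<Rightarrow> complex"
  assumes f: "continuous_on {0..1} f" and g: "continuous_on {0..1} g"
    and eq: "\<And>t. t \<in> {0..1} \<Longrightarrow> exp (f t) = exp (g t)" and 0: "f 0 = g 0" and t: "t \<in> {0..1}"
  shows "f t = g t"
proof -
  have c: "continuous_on {0..1} (\<lambda>t. exp (f t))" by (intro continuous_intros f)
  show ?thesis
    by (rule covering_space_lift_unique[OF covering_space_exp_punctured_plane 0 c _ f _ _ g _ _ _ _ t])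
      (use eq in auto)
qed

lemma continuous_on_slice:
  assumes "continuous_on (A \<times> U) k"
  shows "a \<in> A \<Longrightarrow> continuous_on U (\<lambda>y. k (a, y))"
    and "y \<in> U \<Longrightarrow> continuous_on A (\<lambda>t. k (t, y))"
  by (rule continuous_on_compose2[OF assms]; auto intro!: continuous_intros)+

lemma exp_eq_imp_Im_int:
  assumes "exp a = exp b"
  shows "(Im a - Im b) / (2 * pi) \<in> \<int>"
proof -
  obtain n :: int where "a = b + of_real (of_int (2 * n) * pi) * \<i>"
    using assms unfolding exp_eq by (rule exE)
  then have "(Im a - Im b) / (2 * pi) = of_int n" by simp
  then show ?thesis by simp
qed

lemma lattice_nth: "z \<in> lattice \<Longrightarrow> z $ i \<in> \<int>"
  by (simp add: lattice_def)

lemma cis_add_int: "n \<in> \<int> \<Longrightarrow> cis (2 * pi * (x + n)) = cis (2 * pi * x)"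
  by (simp add: distrib_left cis_multiple_2pi flip: cis_mult)

lemma exp_add_int: "n \<in> \<int> \<Longrightarrow> exp (x + of_real (2 * pi * n) * \<i>) = exp x"
  using cis_multiple_2pi[of n] by (simp add: exp_add cis_conv_exp mult.commute)

text \<open>Two logarithms of one path that initially differ by a period do so at all times.\<close>
lemma log_lift_translate:
  fixes K :: "real \<times> 'c::real_normed_vector \<Rightarrow> complex"
  assumes K: "continuous_on ({0..1} \<times> P) K" "p \<in> P" "q \<in> P" "n \<in> \<int>"
    and "\<And>s. s \<in> {0..1} \<Longrightarrow> exp (K (s, q)) = exp (K (s, p))"
    and "K (0, q) = K (0, p) + of_real (2 * pi * n) * \<i>" and t: "t \<in> {0..1}"
  shows "K (t, q) = K (t, p) + of_real (2 * pi * n) * \<i>"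
proof (rule log_lift_unique[OF _ _ _ _ t])
  show "continuous_on {0..1} (\<lambda>t. K (t, q))" by (rule continuous_on_slice(2)[OF K(1,3)])
  show "continuous_on {0..1} (\<lambda>t. K (t, p) + of_real (2 * pi * n) * \<i>)"
    by (intro continuous_intros continuous_on_slice(2)[OF K(1,2)])
qed (simp_all only: assms exp_add_int)

text \<open>Here \<open>\<sigma>\<close> and \<open>\<delta>\<close> are the sum and the discriminant of a moving pair, that is, its coordinates as an
  unordered pair. A continuous root \<open>R\<close> of \<open>\<delta>\<close>, obtained from a logarithm, separates the pair into
  \<open>A\<close> and \<open>B\<close>. At time \<open>1\<close> the numbers \<open>A\<close> and \<open>B\<close> lie in the right half plane, where the principal
  logarithm is continuous, and lifted and principal logarithms differ there by integer multiples of
  the period.\<close>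
lemma equivariant_labels:
  fixes P :: "(real ^ 3) set" and \<sigma> \<delta> :: "real \<times> (real ^ 3) \<Rightarrow> complex"
  assumes \<sigma>: "continuous_on ({0..1} \<times> P) \<sigma>" and \<delta>: "continuous_on ({0..1} \<times> P) \<delta>"
    and \<delta>0: "\<And>t p. t \<in> {0..1} \<Longrightarrow> p \<in> P \<Longrightarrow> \<delta> (t, p) \<noteq> 0"
    and \<sigma>\<delta>: "\<And>t p. t \<in> {0..1} \<Longrightarrow> p \<in> P \<Longrightarrow> (\<sigma> (t, p))\<^sup>2 \<noteq> \<delta> (t, p)"
    and start: "\<And>p. p \<in> P \<Longrightarrow> \<sigma> (0, p) = cis (2 * pi * p $ 1) + 2 * cis (2 * pi * p $ 2)"
      "\<And>p. p \<in> P \<Longrightarrow> \<delta> (0, p) = (cis (2 * pi * p $ 1) - 2 * cis (2 * pi * p $ 2))\<^sup>2"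
    and final: "\<And>p. p \<in> P \<Longrightarrow> \<sigma> (1, p) = 6" "\<And>p. p \<in> P \<Longrightarrow> \<delta> (1, p) = 4 * cis (2 * pi * p $ 3)"
    and inv: "\<And>p z. p \<in> P \<Longrightarrow> z \<in> lattice \<Longrightarrow> p + z \<in> P"
      "\<And>t p z. t \<in> {0..1} \<Longrightarrow> p \<in> P \<Longrightarrow> z \<in> lattice \<Longrightarrow> \<sigma> (t, p + z) = \<sigma> (t, p)"
      "\<And>t p z. t \<in> {0..1} \<Longrightarrow> p \<in> P \<Longrightarrow> z \<in> lattice \<Longrightarrow> \<delta> (t, p + z) = \<delta> (t, p)"
  shows "\<exists>\<kappa> :: real ^ 3 \<Rightarrow> real ^ 3. continuous_on P \<kappa> \<and> (\<forall>p\<in>P. \<kappa> p \<in> lattice) \<and>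
    (\<forall>p\<in>P. \<forall>z\<in>lattice. \<kappa> (p + z) = \<kappa> p + z)"
proof -
  have I: "(0::real) \<in> {0..1}" "(1::real) \<in> {0..1}" by auto
  \<comment> \<open>Twice a logarithm of \<open>2 cis (2\<pi>v) - cis (2\<pi>u)\<close>, continuous on the whole space since \<open>2 - cis (2\<pi>(u - v))\<close> lies in the right half plane.\<close>
  define f where "f p = 2 * (of_real (2 * pi * p $ 2) * \<i> + Ln (2 - cis (2 * pi * (p $ 1 - p $ 2))))" for p :: "real ^ 3"
  have Re2: "Re (2 - cis x) > 0" for x
  proof -
    have "cos x < 2" by (rule order_le_less_trans[OF cos_le_one]) simp
    then show ?thesis by simp
  qed
  have notneg: "2 - cis x \<notin> \<real>\<^sub>\<le>\<^sub>0" for x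
    using Re2[of x] by (auto simp: complex_nonpos_Reals_iff)
  have f0: "exp (f p / 2) = 2 * cis (2 * pi * p $ 2) - cis (2 * pi * p $ 1)" for p
  proof -
    have "2 - cis (2 * pi * (p $ 1 - p $ 2)) \<noteq> 0" using Re2[of "2 * pi * (p $ 1 - p $ 2)"] by (metis less_irrefl zero_complex.sel(1))
    moreover have "f p / 2 = \<i> * of_real (2 * pi * p $ 2) + Ln (2 - cis (2 * pi * (p $ 1 - p $ 2)))"
      by (simp add: f_def)
    ultimately have "exp (f p / 2) = cis (2 * pi * p $ 2) * (2 - cis (2 * pi * (p $ 1 - p $ 2)))"
      by (simp only: exp_add exp_Ln cis_conv_exp simp_thms)
    also have "\<dots> = 2 * cis (2 * pi * p $ 2) - cis (2 * pi * p $ 1)"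
      by (simp add: right_diff_distrib cis_mult)
    finally show ?thesis .
  qed
  have contf: "continuous_on P f"
    unfolding f_def by (intro continuous_intros notneg)
  have fexp: "\<delta> (0, p) = exp (f p)" if "p \<in> P" for p
  proof -
    have "exp (f p) = (exp (f p / 2))\<^sup>2" by (simp add: exp_double[symmetric])
    then show ?thesis unfolding f0 start(2)[OF that] by (simp add: power2_commute)
  qed
  obtain L where L: "continuous_on ({0..1} \<times> P) L" "\<And>p. p \<in> P \<Longrightarrow> L (0, p) = f p"
    "\<And>t p. t \<in> {0..1} \<Longrightarrow> p \<in> P \<Longrightarrow> exp (L (t, p)) = \<delta> (t, p)"
    by (rule log_lift[OF \<delta> \<delta>0 contf fexp]) (assumption+, rule that)
  define R where "R x = exp (L x / 2)" for x
  have contR: "continuous_on ({0..1} \<times> P) R"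
    unfolding R_def by (intro continuous_intros L) auto
  have R2: "(R (t, p))\<^sup>2 = \<delta> (t, p)" if "t \<in> {0..1}" "p \<in> P" for t p
    using L(3)[OF that] by (simp add: R_def exp_double[symmetric])
  define A where "A x = (\<sigma> x - R x) / 2" for x
  define B where "B x = (\<sigma> x + R x) / 2" for x
  have AB: "A (t, p) \<noteq> 0" "B (t, p) \<noteq> 0" if "t \<in> {0..1}" "p \<in> P" for t p
  proof -
    have "4 * (A (t, p) * B (t, p)) = (\<sigma> (t, p))\<^sup>2 - (R (t, p))\<^sup>2"
      by (simp add: A_def B_def field_simps power2_eq_square)
    also have "\<dots> \<noteq> 0" unfolding R2[OF that] using \<sigma>\<delta>[OF that] by simp
    finally show "A (t, p) \<noteq> 0" "B (t, p) \<noteq> 0" by auto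
  qed
  have contA: "continuous_on ({0..1} \<times> P) A" and contB: "continuous_on ({0..1} \<times> P) B"
    unfolding A_def B_def by (intro continuous_intros contR \<sigma>; simp)+
  have R0: "R (0, p) = 2 * cis (2 * pi * p $ 2) - cis (2 * pi * p $ 1)" if "p \<in> P" for p
    unfolding R_def L(2)[OF that] by (rule f0)
  have A0: "A (0, p) = exp (of_real (2 * pi * p $ 1) * \<i>)" if "p \<in> P" for p
    unfolding A_def R0[OF that] start(1)[OF that] by (simp add: cis_conv_exp mult.commute)
  have B0: "B (0, p) = exp (of_real (ln 2) + of_real (2 * pi * p $ 2) * \<i>)" if "p \<in> P" for p
    unfolding B_def R0[OF that] start(1)[OF that]
    by (simp add: cis_conv_exp mult.commute exp_add exp_of_real)
  have cA: "continuous_on P (\<lambda>p::real^3. of_real (2 * pi * p $ 1) * \<i>)"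
    and cB: "continuous_on P (\<lambda>p::real^3. of_real (ln 2) + of_real (2 * pi * p $ 2) * \<i>)"
    by (intro continuous_intros)+
  obtain LA where LA: "continuous_on ({0..1} \<times> P) LA" "\<And>p. p \<in> P \<Longrightarrow> LA (0, p) = of_real (2 * pi * p $ 1) * \<i>"
    "\<And>t p. t \<in> {0..1} \<Longrightarrow> p \<in> P \<Longrightarrow> exp (LA (t, p)) = A (t, p)"
    by (rule log_lift[OF contA AB(1) cA A0]) (assumption+, rule that)
  obtain LB where LB: "continuous_on ({0..1} \<times> P) LB"
    "\<And>p. p \<in> P \<Longrightarrow> LB (0, p) = of_real (ln 2) + of_real (2 * pi * p $ 2) * \<i>"
    "\<And>t p. t \<in> {0..1} \<Longrightarrow> p \<in> P \<Longrightarrow> exp (LB (t, p)) = B (t, p)"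
    by (rule log_lift[OF contB AB(2) cB B0]) (assumption+, rule that)
  have Re1: "Re (A (1, p)) > 0" "Re (B (1, p)) > 0" if "p \<in> P" for p
  proof -
    have "(norm (R (1, p)))\<^sup>2 = 4"
      using arg_cong[OF R2[OF I(2) that], of norm] by (simp add: final(2)[OF that] norm_power norm_mult)
    then have "norm (R (1, p)) = 2"
      using power2_eq_iff_nonneg[of "norm (R (1, p))" 2] by simp
    then have "\<bar>Re (R (1, p))\<bar> \<le> 2" using abs_Re_le_cmod[of "R (1, p)"] by simp
    then show "Re (A (1, p)) > 0" "Re (B (1, p)) > 0"
      by (auto simp: A_def B_def final(1)[OF that])
  qed
  have notneg1: "A (1, p) \<notin> \<real>\<^sub>\<le>\<^sub>0" "B (1, p) \<notin> \<real>\<^sub>\<le>\<^sub>0" if "p \<in> P" for p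
    using Re1[OF that] by (auto simp: complex_nonpos_Reals_iff)
  define k1 where "k1 p = (Im (LA (1, p)) - Im (Ln (A (1, p)))) / (2 * pi)" for p
  define k2 where "k2 p = (Im (LB (1, p)) - Im (Ln (B (1, p)))) / (2 * pi)" for p
  define n where "n p = (Im (L (1, p)) - 2 * pi * p $ 3) / (2 * pi)" for p :: "real ^ 3"
  \<comment> \<open>Translation by \<open>z\<close> adds \<open>z\<^sub>1\<close>, \<open>z\<^sub>2\<close> and \<open>2z\<^sub>2 - z\<^sub>3\<close> to \<open>k1\<close>, \<open>k2\<close> and \<open>n\<close>; the third coordinate is chosen to change by \<open>z\<^sub>3\<close>.\<close>
  define \<kappa> where "\<kappa> p = (vector [k1 p, k2 p, 2 * k2 p - n p] :: real ^ 3)" for p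
  have int: "k1 p \<in> \<int>" "k2 p \<in> \<int>" "n p \<in> \<int>" if "p \<in> P" for p
  proof -
    show "k1 p \<in> \<int>" unfolding k1_def using AB[OF I(2) that] LA(3)[OF I(2) that]
      by (intro exp_eq_imp_Im_int) simp
    show "k2 p \<in> \<int>" unfolding k2_def using AB[OF I(2) that] LB(3)[OF I(2) that]
      by (intro exp_eq_imp_Im_int) simp
    have "exp (L (1, p)) = exp (of_real (ln 4) + of_real (2 * pi * p $ 3) * \<i>)"
      unfolding L(3)[OF I(2) that] final(2)[OF that] exp_add exp_of_real
      by (simp add: cis_conv_exp mult.commute)
    then show "n p \<in> \<int>"
      unfolding n_def by (drule_tac exp_eq_imp_Im_int) simp
  qed
  have shift: "k1 (p + z) = k1 p + z $ 1" "k2 (p + z) = k2 p + z $ 2" "n (p + z) = n p + 2 * z $ 2 - z $ 3"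
    if p: "p \<in> P" and z: "z \<in> lattice" for p z
  proof -
    have zi: "z $ i \<in> \<int>" for i using z by (rule lattice_nth)
    have pz: "p + z \<in> P" using inv(1)[OF p z] .
    have fz: "f (p + z) = f p + of_real (2 * pi * (2 * z $ 2)) * \<i>"
    proof -
      have "cis (2 * pi * ((p + z) $ 1 - (p + z) $ 2)) = cis (2 * pi * (p $ 1 - p $ 2))"
        using cis_add_int[of "z $ 1 - z $ 2" "p $ 1 - p $ 2"] zi by (simp add: algebra_simps)
      then show ?thesis unfolding f_def by (simp add: algebra_simps)
    qed
    have Lz: "L (t, p + z) = L (t, p) + of_real (2 * pi * (2 * z $ 2)) * \<i>" if "t \<in> {0..1}" for t
      by (rule log_lift_translate[OF L(1) p pz _ _ _ that])
        (use fz zi L(2)[OF p] L(2)[OF pz] L(3)[OF _ p] L(3)[OF _ pz] inv(3)[OF _ p z] in simp_all)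
    have Rz: "R (t, p + z) = R (t, p)" if "t \<in> {0..1}" for t
    proof -
      have "R (t, p + z) = exp (L (t, p) / 2 + of_real (2 * pi * z $ 2) * \<i>)"
        unfolding R_def Lz[OF that] by (simp add: add_divide_distrib mult_ac)
      then show ?thesis using exp_add_int[OF zi] by (simp add: R_def)
    qed
    have Az: "A (t, p + z) = A (t, p)" and Bz: "B (t, p + z) = B (t, p)" if "t \<in> {0..1}" for t
      using Rz[OF that] inv(2)[OF that p z] by (simp_all add: A_def B_def)
    have "LA (0, p + z) = LA (0, p) + of_real (2 * pi * z $ 1) * \<i>"
      unfolding LA(2)[OF p] LA(2)[OF pz] by (simp add: algebra_simps)
    then have LAz: "LA (t, p + z) = LA (t, p) + of_real (2 * pi * z $ 1) * \<i>" if "t \<in> {0..1}" for t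
      by (intro log_lift_translate[OF LA(1) p pz zi _ _ that]) (simp_all only: LA(3)[OF _ p] LA(3)[OF _ pz] Az)
    have "LB (0, p + z) = LB (0, p) + of_real (2 * pi * z $ 2) * \<i>"
      unfolding LB(2)[OF p] LB(2)[OF pz] by (simp add: algebra_simps)
    then have LBz: "LB (t, p + z) = LB (t, p) + of_real (2 * pi * z $ 2) * \<i>" if "t \<in> {0..1}" for t
      by (intro log_lift_translate[OF LB(1) p pz zi _ _ that]) (simp_all only: LB(3)[OF _ p] LB(3)[OF _ pz] Bz)
    show "k1 (p + z) = k1 p + z $ 1"
      unfolding k1_def LAz[OF I(2)] Az[OF I(2)] by (simp add: field_simps)
    show "k2 (p + z) = k2 p + z $ 2"
      unfolding k2_def LBz[OF I(2)] Bz[OF I(2)] by (simp add: field_simps)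
    show "n (p + z) = n p + 2 * z $ 2 - z $ 3"
      unfolding n_def Lz[OF I(2)] by (simp add: field_simps)
  qed
  have "continuous_on P (\<lambda>p. Ln (A (1, p)))"
    by (rule continuous_on_Ln', rule continuous_on_slice(1)[OF contA I(2)], erule notneg1)
  moreover have "continuous_on P (\<lambda>p. Ln (B (1, p)))"
    by (rule continuous_on_Ln', rule continuous_on_slice(1)[OF contB I(2)], erule notneg1)
  ultimately have cLn: "continuous_on P (\<lambda>p. Ln (A (1, p)))" "continuous_on P (\<lambda>p. Ln (B (1, p)))"
    by simp_all
  have c1: "continuous_on P (\<lambda>p. LA (1, p))" "continuous_on P (\<lambda>p. LB (1, p))" "continuous_on P (\<lambda>p. L (1, p))"
    using continuous_on_slice(1)[OF LA(1) I(2)] continuous_on_slice(1)[OF LB(1) I(2)]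
      continuous_on_slice(1)[OF L(1) I(2)] by simp_all
  have contk: "continuous_on P k1" "continuous_on P k2" "continuous_on P n"
    unfolding k1_def k2_def n_def divide_inverse
    by (rule continuous_on_mult continuous_on_const continuous_on_diff continuous_on_Im c1 cLn
        continuous_on_component continuous_on_id)+
  have "continuous_on P (\<lambda>p. \<kappa> p $ j)" for j
  proof -
    have "continuous_on P (\<lambda>p. 2 * k2 p - n p)" by (intro continuous_intros contk)
    then show ?thesis using exhaust_3[of j] contk by (elim disjE) (simp_all add: \<kappa>_def)
  qed
  then have "continuous_on P (\<lambda>p. \<chi> j. \<kappa> p $ j)" by (rule continuous_on_vec_lambda)
  then have "continuous_on P \<kappa>" by simp
  moreover have "\<forall>p\<in>P. \<kappa> p \<in> lattice"
    using int by (simp add: lattice_def \<kappa>_def forall_3)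
  moreover have "\<forall>p\<in>P. \<forall>z\<in>lattice. \<kappa> (p + z) = \<kappa> p + z"
    using shift by (simp add: vec_eq_iff \<kappa>_def forall_3)
  ultimately show ?thesis by blast
qed

text \<open>Independent rotations of the two points on concentric circles: a torus in the configuration space.\<close>
definition base_fst :: "real ^ 3 \<Rightarrow> complex \<times> complex" where
  "base_fst p = (cis (2 * pi * p $ 1), 2 * cis (2 * pi * p $ 2))"

text \<open>A half turn of two points about each other, away from the puncture: the unordered pair is a loop of
  period \<open>1\<close> in the third coordinate, which exchanges the two points.\<close>
definition base_snd :: "real ^ 3 \<Rightarrow> complex \<times> complex" where
  "base_snd p = (3 + cis (pi * p $ 3), 3 - cis (pi * p $ 3))"

lemma base_fst_mem: "base_fst p \<in> ordered_conf"
proof -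
  have "cis x \<noteq> 2 * cis y" for x y
  proof
    assume "cis x = 2 * cis y"
    then have "norm (cis x) = norm (2 * cis y)" by (rule arg_cong)
    then show False by (simp add: norm_mult)
  qed
  then show ?thesis by (simp add: base_fst_def ordered_conf_def)
qed

lemma base_snd_mem: "base_snd p \<in> ordered_conf"
proof -
  have "Re (3 + cis x) > 0" "Re (3 - cis x) > 0" for x
    using cos_ge_minus_one[of x] cos_le_one[of x] by (simp_all del: cos_ge_minus_one cos_le_one)
  then have "3 + cis x \<noteq> 0" "3 - cis x \<noteq> 0" for x
    by (metis less_irrefl zero_complex.sel(1))+
  moreover have "3 + cis x \<noteq> 3 - cis x" for x by (simp add: eq_diff_eq)
  ultimately show ?thesis unfolding base_snd_def ordered_conf_def by simp
qed

lemma base_fst_translate: "z \<in> lattice \<Longrightarrow> base_fst (p + z) = base_fst p"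
  by (simp only: base_fst_def vector_add_component cis_add_int lattice_nth)

lemma base_snd_translate:
  assumes "z \<in> lattice"
  shows "base_snd (p + z) = base_snd p \<or> base_snd (p + z) = prod.swap (base_snd p)"
proof -
  have "(cis (pi * z $ 3))\<^sup>2 = 1"
    using cis_multiple_2pi[OF lattice_nth[OF assms], of 3] by (simp add: power2_eq_square cis_mult algebra_simps)
  then have "cis (pi * z $ 3) = 1 \<or> cis (pi * z $ 3) = - 1" by (simp add: power2_eq_1_iff)
  then have "cis (pi * (p + z) $ 3) = cis (pi * p $ 3) \<or> cis (pi * (p + z) $ 3) = - cis (pi * p $ 3)"
    by (auto simp: distrib_left simp flip: cis_mult)
  then show ?thesis unfolding base_snd_def by (elim disjE) simp_all
qed

lemma continuous_on_base: "continuous_on S base_fst" "continuous_on S base_snd"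
  unfolding base_fst_def base_snd_def by (intro continuous_intros)+

context
  fixes x0 :: "real ^ 2"
begin

text \<open>The sum and the discriminant do not depend on the order of the points, so they are continuous functions
  on the configuration space and can be followed along the motion planned between the base points.\<close>
lemma path_section_imp_labels:
  assumes s: "path_section (mtopology_of (conf_metric x0)) E s"
  defines "base \<equiv> \<lambda>p. (unordered x0 (base_fst p), unordered x0 (base_snd p))"
  defines "P \<equiv> {p. base p \<in> E}"
  shows "\<exists>\<kappa> :: real ^ 3 \<Rightarrow> real ^ 3. continuous_on P \<kappa> \<and> (\<forall>p\<in>P. \<kappa> p \<in> lattice) \<and>
    (\<forall>p\<in>P. \<forall>z\<in>lattice. \<kappa> (p + z) = \<kappa> p + z)"
    and "\<And>p z. p \<in> P \<Longrightarrow> z \<in> lattice \<Longrightarrow> p + z \<in> P"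
proof -
  have base_z: "base (p + z) = base p" if "z \<in> lattice" for p z
    using base_fst_translate[OF that, of p] base_snd_translate[OF that, of p]
    unfolding base_def by (elim disjE) simp_all
  show inv: "p + z \<in> P" if "p \<in> P" "z \<in> lattice" for p z
    using that base_z by (simp add: P_def)
  let ?conf_metric = "mtopology_of (conf_metric x0)"
  obtain hS where hS: "continuous_map ?conf_metric euclidean hS"
    "\<And>q. q \<in> ordered_conf \<Longrightarrow> hS (unordered x0 q) = fst q + snd q"
    by (rule continuous_map_lift_unordered[of "\<lambda>q. fst q + snd q" x0])
      (auto intro!: continuous_intros simp: add.commute)
  obtain hD where hD: "continuous_map ?conf_metric euclidean hD"
    "\<And>q. q \<in> ordered_conf \<Longrightarrow> hD (unordered x0 q) = (fst q - snd q)\<^sup>2"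
    by (rule continuous_map_lift_unordered[of "\<lambda>q. (fst q - snd q)\<^sup>2" x0])
      (auto intro!: continuous_intros simp: power2_commute)
  have sec: "continuous_map (subtopology (prod_topology ?conf_metric ?conf_metric) E) (path_space ?conf_metric) s"
    "\<And>A B. (A, B) \<in> E \<Longrightarrow> s (A, B) \<in> topspace (path_space_between ?conf_metric A B)"
    using s unfolding path_section_def by blast+
  have sP: "continuous_map unit_interval ?conf_metric (s (base p))" "s (base p) 0 = unordered x0 (base_fst p)"
    "s (base p) 1 = unordered x0 (base_snd p)" if "p \<in> P" for p
    using sec(2)[of "unordered x0 (base_fst p)" "unordered x0 (base_snd p)"] that
    by (simp_all add: P_def base_def topspace_path_space_between)
  have cb: "continuous_map (top_of_set P) ?conf_metric (\<lambda>p. unordered x0 (b p))"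
    if "continuous_on P b" "\<And>p. b p \<in> ordered_conf" for b
    using continuous_map_compose[OF _ continuous_map_unordered[of x0], of "top_of_set P" b] that
    by (simp add: o_def continuous_map_in_subtopology image_subset_iff)
  have "continuous_map (top_of_set P) (subtopology (prod_topology ?conf_metric ?conf_metric) E) base"
    unfolding base_def
    by (intro continuous_map_into_subtopology continuous_map_pairedI cb continuous_on_base base_fst_mem base_snd_mem)
      (auto simp: P_def base_def)
  from continuous_map_compose[OF this sec(1)]
  have "continuous_map (top_of_set P) (path_space ?conf_metric) (\<lambda>p. s (base p))" by (simp add: o_def)
  then have H: "continuous_map (top_of_set (P \<times> {0..1})) ?conf_metric (\<lambda>(p, t). s (base p) t)"
    unfolding continuous_map_path_space_iff by simp
  have cont: "continuous_on ({0..1} \<times> P) (\<lambda>x. h (s (base (snd x)) (fst x)))"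
    if "continuous_map ?conf_metric euclidean h" for h :: "(real ^ 2) set \<Rightarrow> complex"
  proof -
    have "continuous_map (top_of_set (P \<times> {0..1})) euclidean (h \<circ> (\<lambda>(p, t). s (base p) t))"
      by (rule continuous_map_compose[OF H that])
    then have "continuous_on (P \<times> {0..1}) (\<lambda>x. h (s (base (fst x)) (snd x)))"
      by (simp add: o_def case_prod_unfold)
    then have "continuous_on ({0..1} \<times> P) ((\<lambda>x. h (s (base (fst x)) (snd x))) \<circ> prod.swap)"
      by (intro continuous_on_compose) (auto simp: product_swap intro!: continuous_intros)
    then show ?thesis by (simp add: o_def)
  qed
  have rep: "\<exists>q\<in>ordered_conf. s (base p) t = unordered x0 q" if "p \<in> P" "t \<in> {0..1}" for p t
  proof -
    have "s (base p) t \<in> mspace (conf_metric x0)"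
      using continuous_map_image_subset_topspace[OF sP(1)[OF that(1)]] that(2) by auto
    then show ?thesis unfolding unordered_image[symmetric] by (elim imageE) blast
  qed
  show "\<exists>\<kappa> :: real ^ 3 \<Rightarrow> real ^ 3. continuous_on P \<kappa> \<and> (\<forall>p\<in>P. \<kappa> p \<in> lattice) \<and>
    (\<forall>p\<in>P. \<forall>z\<in>lattice. \<kappa> (p + z) = \<kappa> p + z)"
  proof (rule equivariant_labels[OF cont[OF hS(1)] cont[OF hD(1)]], goal_cases)
    case (1 t p)
    then obtain q where q: "q \<in> ordered_conf" "s (base p) t = unordered x0 q" using rep by blast
    then show ?case using hD(2)[OF q(1)] by (auto simp: ordered_conf_def)
  next
    case (2 t p)
    then obtain q where q: "q \<in> ordered_conf" "s (base p) t = unordered x0 q" using rep by blast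
    have "(fst q + snd q)\<^sup>2 - (fst q - snd q)\<^sup>2 = 4 * fst q * snd q"
      by (simp add: power2_eq_square algebra_simps)
    also have "\<dots> \<noteq> 0" using q(1) by (auto simp: ordered_conf_def)
    finally show ?case using q(2) hS(2)[OF q(1)] hD(2)[OF q(1)] by simp
  next
    case (3 p)
    then show ?case using sP(2) hS(2)[OF base_fst_mem] by (simp add: base_fst_def)
  next
    case (4 p)
    then show ?case using sP(2) hD(2)[OF base_fst_mem] by (simp add: base_fst_def)
  next
    case (5 p)
    then show ?case using sP(3) hS(2)[OF base_snd_mem] by (simp add: base_snd_def)
  next
    case (6 p)
    have "(cis (pi * p $ 3))\<^sup>2 = cis (2 * pi * p $ 3)"
      by (simp add: power2_eq_square cis_mult mult.assoc)
    with 6 show ?case using sP(3) hD(2)[OF base_snd_mem] by (simp add: base_snd_def power_mult_distrib)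
  next
    case (7 p z)
    then show ?case by (rule inv)
  qed (simp_all add: base_z)
qed

lemma TC_ge_3: "3 \<le> TC (mtopology_of (conf_metric x0))"
  unfolding TC_eq_path_section
proof (rule Inf_greatest, clarify)
  fix k E
  assume lc: "lc_partition (mtopology_of (conf_metric x0)) k E"
    and s: "\<forall>i\<le>k. \<exists>s. path_section (mtopology_of (conf_metric x0)) (E i) s"
  define base where "base p = (unordered x0 (base_fst p), unordered x0 (base_snd p))" for p
  define P where "P i = {p. base p \<in> E i}" for i
  have s': "\<exists>s. path_section (mtopology_of (conf_metric x0)) (E i) s" if "i \<le> k" for i using s that by blast
  have "\<exists>\<kappa>. continuous_on (P i) \<kappa> \<and> (\<forall>p\<in>P i. \<kappa> p \<in> lattice) \<and>
      (\<forall>p\<in>P i. \<forall>z\<in>lattice. \<kappa> (p + z) = \<kappa> p + z)" if i: "i \<le> k" for i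
    using s'[OF i] path_section_imp_labels(1) unfolding P_def base_def by (elim exE) blast
  then obtain \<kappa> where \<kappa>: "\<And>i. i \<le> k \<Longrightarrow> continuous_on (P i) (\<kappa> i)"
    "\<And>i p. i \<le> k \<Longrightarrow> p \<in> P i \<Longrightarrow> \<kappa> i p \<in> lattice"
    "\<And>i p z. i \<le> k \<Longrightarrow> p \<in> P i \<Longrightarrow> z \<in> lattice \<Longrightarrow> \<kappa> i (p + z) = \<kappa> i p + z"
    by metis
  have inv: "p + z \<in> P i" if "i \<le> k" "p \<in> P i" "z \<in> lattice" for i p z
    using s'[OF that(1)] path_section_imp_labels(2) that(2,3) unfolding P_def base_def by (elim exE) blast
  have "base p \<in> mspace (conf_metric x0) \<times> mspace (conf_metric x0)" for p
    using imageI[OF base_fst_mem, of "unordered x0"] imageI[OF base_snd_mem, of "unordered x0"]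
    unfolding base_def unordered_image by simp
  then have "(\<Union>i\<le>k. P i) = UNIV"
    using lc by (auto simp: lc_partition_def P_def)
  then have "CARD(3) \<le> k"
    by (rule equivariant_labels_imp_card[OF _ inv \<kappa>])
  then have "(3::nat) \<le> k" by simp
  then have "enat 3 \<le> enat k" by (simp only: enat_ord_simps)
  then show "3 \<le> enat k" by (simp add: numeral_eq_enat)
qed

end

section \<open>Matchings, hits and detours\<close>

type_synonym quad = "(complex \<times> complex) \<times> (complex \<times> complex)"

text \<open>For nonzero \<open>a\<close> and \<open>b\<close>: the segment from \<open>a\<close> to \<open>b\<close> passes through \<open>0\<close>, that is, \<open>b\<close> is a negative real
  multiple of \<open>a\<close>. Membership in the nonpositive reals exhibits this as a closed condition.\<close>
definition hits :: "complex \<Rightarrow> complex \<Rightarrow> bool" where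
  "hits a b \<longleftrightarrow> cnj a * b \<in> \<real>\<^sub>\<le>\<^sub>0"

lemma hitsE:
  assumes "hits a b" "a \<noteq> 0" "b \<noteq> 0"
  obtains r where "r > 0" "b = - (of_real r * a)"
proof -
  obtain c where c: "c \<le> 0" "cnj a * b = of_real c"
    using assms(1) unfolding hits_def by (rule nonpos_Reals_cases)
  have n: "(norm a)\<^sup>2 > 0" using assms(2) by simp
  have "of_real ((norm a)\<^sup>2) * b = of_real c * a"
  proof -
    have "of_real ((norm a)\<^sup>2) * b = a * (cnj a * b)"
      by (simp only: complex_norm_square mult.assoc)
    also have "\<dots> = a * of_real c" by (simp only: c(2))
    also have "\<dots> = of_real c * a" by (rule mult.commute)
    finally show ?thesis .
  qed
  then have b: "b = of_real (c / (norm a)\<^sup>2) * a"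
    using n by (simp add: field_simps)
  then have "c \<noteq> 0" using assms(3) by auto
  then have "- c / (norm a)\<^sup>2 > 0" using c(1) n by (simp add: field_simps)
  then show thesis by (rule that) (use b in simp)
qed

lemma hits_imp_segment_zero:
  assumes "hits a b" "a \<noteq> 0" "b \<noteq> 0"
  obtains t where "0 < t" "t < 1" "of_real (1 - t) * a + of_real t * b = 0"
proof -
  obtain r where r: "r > 0" "b = - (of_real r * a)" using assms by (rule hitsE)
  show thesis
  proof (rule that)
    show "0 < 1 / (1 + r)" "1 / (1 + r) < 1" using r(1) by simp_all
    have "of_real (1 - 1 / (1 + r)) - of_real (1 / (1 + r)) * of_real r = (0 :: complex)"
      unfolding of_real_mult[symmetric] of_real_diff[symmetric] using r(1) by (simp add: field_simps)
    then have "(of_real (1 - 1 / (1 + r)) - of_real (1 / (1 + r)) * of_real r) * a = 0" by simp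
    then show "of_real (1 - 1 / (1 + r)) * a + of_real (1 / (1 + r)) * b = 0"
      unfolding r(2) by (simp add: algebra_simps)
  qed
qed

lemma not_hits_imp_segment_nonzero:
  assumes "\<not> hits a b" "a \<noteq> 0" "0 \<le> t" "t \<le> 1"
  shows "of_real (1 - t) * a + of_real t * b \<noteq> 0"
proof
  assume *: "of_real (1 - t) * a + of_real t * b = 0"
  have t: "t > 0"
  proof (rule ccontr)
    assume "\<not> t > 0"
    then have "t = 0" using assms by simp
    then show False using * assms(2) by simp
  qed
  have "of_real t * (cnj a * b) = cnj a * (of_real t * b)" by simp
  also have "of_real t * b = - (of_real (1 - t) * a)" using * by (simp add: add_eq_0_iff)
  also have "cnj a * \<dots> = - (of_real (1 - t) * (a * cnj a))"
    by (simp only: mult_minus_right mult_ac)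
  also have "\<dots> = - of_real ((1 - t) * (norm a)\<^sup>2)"
    by (simp only: complex_norm_square of_real_mult)
  finally have "cnj a * b = of_real (- ((1 - t) * (norm a)\<^sup>2) / t)"
    using t by (simp add: field_simps)
  moreover have "- ((1 - t) * (norm a)\<^sup>2) / t \<le> 0"
    using t assms(4) by (simp add: divide_nonpos_pos)
  ultimately have "hits a b" unfolding hits_def by (simp only: nonpos_Reals_of_real_iff)
  with assms(1) show False by simp
qed

text \<open>The segment from \<open>a\<close> to \<open>b\<close>, bent to the left by a parabola if \<open>h\<close> holds. On a segment through \<open>0\<close> the
  direction of travel is that of \<open>b\<close>, so \<open>\<i> * sgn b\<close> points to the left; unlike the unit vector along
  \<open>b - a\<close>, it is continuous for all \<open>b \<noteq> 0\<close>.\<close>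
definition bend :: "bool \<Rightarrow> real \<Rightarrow> real \<Rightarrow> complex \<Rightarrow> complex \<Rightarrow> complex" where
  "bend h c t a b = of_real (1 - t) * a + of_real t * b + of_real (of_bool h * (c * (t * (1 - t)))) * (\<i> * sgn b)"

text \<open>On a segment through \<open>0\<close> the bump is orthogonal to the segment and vanishes only at the endpoints.\<close>
lemma bend_nonzero:
  assumes ab: "a \<noteq> 0" "b \<noteq> 0" and t: "0 \<le> t" "t \<le> 1" and c: "c > 0"
  shows "bend (hits a b) c t a b \<noteq> 0"
proof (cases "hits a b")
  case False
  then show ?thesis using not_hits_imp_segment_nonzero[OF False ab(1) t] by (simp add: bend_def)
next
  case True
  obtain r where r: "r > 0" "b = - (of_real r * a)" using True ab by (rule hitsE)
  define m where "m = inverse r"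
  have m: "m > 0" "a = - (of_real m * b)" using r by (simp_all add: m_def)
  define k where "k = inverse (norm b)"
  have k: "k > 0" "sgn b = of_real k * b"
    using ab by (simp_all add: k_def sgn_div_norm scaleR_conv_of_real)
  have "bend True c t a b = b * Complex (t - (1 - t) * m) (c * (t * (1 - t)) * k)"
    unfolding bend_def m(2) k(2) by (simp add: complex_eq_iff algebra_simps)
  moreover have "Complex (t - (1 - t) * m) (c * (t * (1 - t)) * k) \<noteq> 0"
  proof
    assume *: "Complex (t - (1 - t) * m) (c * (t * (1 - t)) * k) = 0"
    then have "t * (1 - t) = 0" using c k by (simp add: Complex_eq_0)
    then have "t = 0 \<or> t = 1" by simp
    then show False using * m(1) by (auto simp: Complex_eq_0)
  qed
  ultimately show ?thesis using True ab by simp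
qed

lemma bend_diff:
  "bend h c t a b - bend h c t' a b =
     of_real (t - t') * ((b - a) + of_real (of_bool h * (c * (1 - t - t'))) * (\<i> * sgn b))"
  by (simp add: bend_def algebra_simps)

lemma norm_bump_le:
  assumes "\<bar>c\<bar> \<le> C"
  shows "norm (of_real (of_bool h * c) * (\<i> * sgn b)) \<le> C"
proof -
  have "norm (sgn b :: complex) \<le> 1" by (simp add: norm_sgn)
  then have "\<bar>c\<bar> * norm (sgn b) \<le> C * 1" using assms by (intro mult_mono) auto
  then show ?thesis using assms by (cases h) (auto simp: norm_mult)
qed

definition gap :: "complex \<times> complex \<Rightarrow> complex" where
  "gap p = fst p - snd p"

text \<open>Up to a constant factor, a lower bound for the distance of the two points during the straight motion,
  if the matching is a shortest one.\<close>
definition clearance :: "quad \<Rightarrow> real" where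
  "clearance x = min (norm (gap (fst x))) (norm (gap (snd x)))"

definition route :: "bool \<Rightarrow> bool \<Rightarrow> quad \<Rightarrow> real \<Rightarrow> real \<Rightarrow> complex \<times> complex" where
  "route h h' x s t =
     (bend h (s * clearance x) t (fst (fst x)) (fst (snd x)),
      bend h' (s * clearance x) t (snd (fst x)) (snd (snd x)))"

definition hits_fst :: "quad \<Rightarrow> bool" where "hits_fst x \<longleftrightarrow> hits (fst (fst x)) (fst (snd x))"
definition hits_snd :: "quad \<Rightarrow> bool" where "hits_snd x \<longleftrightarrow> hits (snd (fst x)) (snd (snd x))"

text \<open>The straight motion of the matching \<open>x\<close>, with its hits removed when the parameter \<open>s\<close> is positive.\<close>
definition detour :: "quad \<Rightarrow> real \<Rightarrow> real \<Rightarrow> complex \<times> complex" where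
  "detour x = route (hits_fst x) (hits_snd x) x"

definition gap_inner :: "quad \<Rightarrow> real" where "gap_inner x = gap (fst x) \<bullet> gap (snd x)"
definition gap_orient :: "quad \<Rightarrow> real" where
  "gap_orient x = Re (gap (fst x)) * Im (gap (snd x)) - Im (gap (fst x)) * Re (gap (snd x))"

text \<open>The sign of the inner product of the two differences tells which of the two matchings is shorter.\<close>
lemma dist_swap_gap: "(dist p (prod.swap q))\<^sup>2 = (dist p q)\<^sup>2 + 2 * gap_inner (p, q)"
  by (simp add: dist_prod_def gap_def gap_inner_def dist_norm cmod_power2 inner_complex_def)
     (simp add: power2_eq_square algebra_simps)

lemma dist_le_dist_swap: "0 \<le> gap_inner (p, q) \<Longrightarrow> dist p q \<le> dist p (prod.swap q)"
  by (rule power2_le_imp_le) (simp_all add: dist_swap_gap)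

abbreviation conf_pairs :: "quad set" where
  "conf_pairs \<equiv> ordered_conf \<times> ordered_conf"

lemma gap_nonzero: "p \<in> ordered_conf \<Longrightarrow> gap p \<noteq> 0"
  by (auto simp: ordered_conf_def gap_def)

lemma clearance_pos: "x \<in> conf_pairs \<Longrightarrow> clearance x > 0"
  using gap_nonzero by (auto simp: clearance_def)

text \<open>With a nonnegative inner product the straight motion keeps the points at distance at least
  \<open>1 / sqrt 2\<close> times the clearance, and each of the two bumps is at most a quarter of the clearance.\<close>
lemma detour_apart:
  assumes x: "x \<in> conf_pairs" and gap_inner: "0 \<le> gap_inner x" and s: "0 \<le> s" "s \<le> 1" and t: "0 \<le> t" "t \<le> 1"
  shows "fst (detour x s t) \<noteq> snd (detour x s t)"
proof
  let ?u = "gap (fst x)" and ?v = "gap (snd x)" and ?k = "clearance x"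
  let ?c = "s * ?k * (t * (1 - t))"
  let ?w = "\<lambda>h b. of_real (of_bool h * ?c) * (\<i> * sgn b) :: complex"
  assume eq: "fst (detour x s t) = snd (detour x s t)"
  have k: "?k > 0" using clearance_pos[OF x] .
  have "of_real (1 - t) * ?u + of_real t * ?v = ?w (hits_snd x) (snd (snd x)) - ?w (hits_fst x) (fst (snd x))"
    using eq by (simp add: detour_def route_def bend_def gap_def algebra_simps)
  then have "norm (of_real (1 - t) * ?u + of_real t * ?v) \<le> norm (?w (hits_snd x) (snd (snd x))) + norm (?w (hits_fst x) (fst (snd x)))"
    by (simp only: norm_triangle_ineq4)
  also have "\<dots> \<le> ?k / 4 + ?k / 4"
  proof -
    have "t * (1 - t) \<le> 1 / 4" using sum_squares_ge_zero[of "t - 1/2" 0] by (simp add: algebra_simps)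
    moreover have "s * ?k \<le> ?k" using s k by simp
    ultimately have "?c \<le> ?k * (1 / 4)" using s t k by (intro mult_mono) auto
    moreover have "?c \<ge> 0" using s t k by simp
    ultimately have "\<bar>?c\<bar> \<le> ?k / 4" by simp
    then show ?thesis by (intro add_mono norm_bump_le)
  qed
  finally have "norm (of_real (1 - t) * ?u + of_real t * ?v) \<le> ?k / 2" by simp
  then have "(norm (of_real (1 - t) * ?u + of_real t * ?v))\<^sup>2 \<le> (?k / 2)\<^sup>2" by (rule power_mono) simp
  moreover have "(norm (of_real (1 - t) * ?u + of_real t * ?v))\<^sup>2 =
      (1 - t)\<^sup>2 * (norm ?u)\<^sup>2 + t\<^sup>2 * (norm ?v)\<^sup>2 + 2 * (t * (1 - t)) * gap_inner x"
    unfolding gap_inner_def inner_complex_def cmod_power2 by (simp add: power2_eq_square algebra_simps)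
  moreover have "(norm ?u)\<^sup>2 \<ge> ?k\<^sup>2" "(norm ?v)\<^sup>2 \<ge> ?k\<^sup>2"
    using k by (auto simp: clearance_def intro!: power_mono)
  then have "(1 - t)\<^sup>2 * (norm ?u)\<^sup>2 \<ge> (1 - t)\<^sup>2 * ?k\<^sup>2" "t\<^sup>2 * (norm ?v)\<^sup>2 \<ge> t\<^sup>2 * ?k\<^sup>2"
    by (auto intro: mult_left_mono)
  moreover have "2 * (t * (1 - t)) * gap_inner x \<ge> 0" using gap_inner t by simp
  ultimately have "(1 - t)\<^sup>2 * ?k\<^sup>2 + t\<^sup>2 * ?k\<^sup>2 \<le> (?k / 2)\<^sup>2" by linarith
  moreover have "(1 - t)\<^sup>2 * ?k\<^sup>2 + t\<^sup>2 * ?k\<^sup>2 = ?k\<^sup>2 / 2 + 2 * (t - 1/2)\<^sup>2 * ?k\<^sup>2"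
    by (simp add: power2_eq_square field_simps)
  moreover have "2 * (t - 1/2)\<^sup>2 * ?k\<^sup>2 \<ge> 0" by simp
  moreover have "?k\<^sup>2 > 0" using k by simp
  ultimately show False by (simp add: power_divide)
qed

lemma detour_in_conf:
  assumes x: "x \<in> conf_pairs" and gap_inner: "0 \<le> gap_inner x" and s: "0 \<le> s" "s \<le> 1" and t: "0 \<le> t" "t \<le> 1"
    and "0 < s \<or> (\<not> hits_fst x \<and> \<not> hits_snd x)"
  shows "detour x s t \<in> ordered_conf"
proof -
  have nz: "fst (fst x) \<noteq> 0" "snd (fst x) \<noteq> 0" "fst (snd x) \<noteq> 0" "snd (snd x) \<noteq> 0"
    using x by (auto simp: ordered_conf_def)
  have "fst (detour x s t) \<noteq> 0 \<and> snd (detour x s t) \<noteq> 0"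
    using assms(7)
  proof
    assume "0 < s"
    then have "s * clearance x > 0" using clearance_pos[OF x] by simp
    then show ?thesis using nz t bend_nonzero
      by (simp add: detour_def route_def hits_fst_def hits_snd_def)
  next
    assume "\<not> hits_fst x \<and> \<not> hits_snd x"
    then show ?thesis using nz t not_hits_imp_segment_nonzero
      by (simp add: detour_def route_def hits_fst_def hits_snd_def bend_def)
  qed
  then show ?thesis
    using detour_apart[OF x gap_inner s t] by (simp add: ordered_conf_def case_prod_unfold)
qed

lemma detour_0: "detour x 0 t = (1 - t) *\<^sub>R fst x + t *\<^sub>R snd x"
  by (simp add: detour_def route_def bend_def prod_eq_iff scaleR_conv_of_real)

lemma detour_endpoints [simp]: "detour x s 0 = fst x" "detour x s 1 = snd x"
  by (simp_all add: detour_def route_def bend_def)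

lemma detour_Lipschitz:
  assumes x: "x \<in> conf_pairs" and s: "0 \<le> s" and t: "0 \<le> t" "t \<le> 1" "0 \<le> t'" "t' \<le> 1"
  shows "dist (detour x s t) (detour x s t') \<le> \<bar>t - t'\<bar> * (dist (fst x) (snd x) + 2 * (s * clearance x))"
proof -
  let ?c = "s * clearance x"
  let ?w = "\<lambda>h b. of_real (of_bool h * (?c * (1 - t - t'))) * (\<i> * sgn b) :: complex"
  let ?W = "(?w (hits_fst x) (fst (snd x)), ?w (hits_snd x) (snd (snd x)))"
  have "detour x s t - detour x s t' = (t - t') *\<^sub>R ((snd x - fst x) + ?W)"
    by (simp add: prod_eq_iff detour_def route_def bend_diff scaleR_conv_of_real)
  then have "dist (detour x s t) (detour x s t') = \<bar>t - t'\<bar> * norm ((snd x - fst x) + ?W)"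
    by (simp add: dist_norm)
  also have "norm ((snd x - fst x) + ?W) \<le> norm (snd x - fst x) + norm ?W" by (rule norm_triangle_ineq)
  also have "norm (snd x - fst x) = dist (fst x) (snd x)" by (simp add: dist_norm norm_minus_commute)
  also have "norm ?W \<le> 2 * ?c"
  proof -
    have c: "0 \<le> ?c" using s clearance_pos[OF x] by simp
    have "\<bar>1 - t - t'\<bar> \<le> 1" using t by simp
    then have "?c * \<bar>1 - t - t'\<bar> \<le> ?c * 1" using c by (rule mult_left_mono)
    then have "\<bar>?c * (1 - t - t')\<bar> \<le> ?c" using c
      by (simp only: abs_mult[of "s * clearance x" "1 - t - t'"] abs_of_nonneg mult_1_right)
    then have "norm (?w h b) \<le> ?c" for h b by (rule norm_bump_le)
    then have "norm (fst ?W) + norm (snd ?W) \<le> ?c + ?c" unfolding fst_conv snd_conv by (intro add_mono)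
    moreover have "norm ?W \<le> norm (fst ?W) + norm (snd ?W)"
      unfolding norm_prod_def by (rule sqrt_sum_squares_le_sum) auto
    ultimately show ?thesis by linarith
  qed
  finally show ?thesis by (simp add: mult_left_mono)
qed

definition cross :: "quad \<Rightarrow> quad" where "cross x = (fst x, prod.swap (snd x))"
definition flip :: "quad \<Rightarrow> quad" where "flip x = (prod.swap (fst x), prod.swap (snd x))"

definition nhits :: "quad \<Rightarrow> nat" where
  "nhits x = of_bool (hits_fst x) + of_bool (hits_snd x)"

text \<open>Says whether the matching as listed is the selected one. Outside ties it is the shorter one. In a tie it
  is the positively oriented one, except that the other one is selected if it is free of hits and the
  positively oriented one is not: this is what the proviso about geodesics in \<open>X\<close> demands.\<close>
definition direct :: "quad \<Rightarrow> bool" where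
  "direct x \<longleftrightarrow> (if gap_inner x \<noteq> 0 then 0 < gap_inner x
     else if 0 < gap_orient x then nhits x = 0 \<or> 0 < nhits (cross x)
     else \<not> (nhits (cross x) = 0 \<or> 0 < nhits x))"

definition matched :: "quad \<Rightarrow> quad" where
  "matched x = (if direct x then x else cross x)"

text \<open>In a tie, the hits of both matchings count. A tie may be a limit of pairs for which either matching is
  the shorter one, and a hit of that matching survives in the limit; it must not be found in a stratum
  of the same index.\<close>
definition codim :: "quad \<Rightarrow> nat" where
  "codim x = (if gap_inner x \<noteq> 0 then nhits (matched x) else Suc (nhits x + nhits (cross x)))"

lemma gap_swap [simp]: "gap (prod.swap p) = - gap p"
  by (simp add: gap_def)

lemma cross_simps [simp]:
  "cross (cross x) = x" "gap_inner (cross x) = - gap_inner x" "gap_orient (cross x) = - gap_orient x"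
  "fst (cross x) = fst x" "snd (cross x) = prod.swap (snd x)"
  by (simp_all add: cross_def gap_inner_def gap_orient_def)

lemma flip_simps [simp]:
  "flip (flip x) = x" "gap_inner (flip x) = gap_inner x" "gap_orient (flip x) = gap_orient x" "nhits (flip x) = nhits x"
  "cross (flip x) = flip (cross x)" "hits_fst (flip x) = hits_snd x" "hits_snd (flip x) = hits_fst x"
  "fst (flip x) = prod.swap (fst x)" "snd (flip x) = prod.swap (snd x)"
  by (simp_all add: cross_def flip_def gap_inner_def gap_orient_def nhits_def hits_fst_def hits_snd_def)

lemma cross_in [simp]: "cross x \<in> conf_pairs \<longleftrightarrow> x \<in> conf_pairs"
  and flip_in [simp]: "flip x \<in> conf_pairs \<longleftrightarrow> x \<in> conf_pairs"
  by (auto simp: cross_def flip_def ordered_conf_def mem_Times_iff)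

lemma gap_inner_orient_norm: "(gap_inner x)\<^sup>2 + (gap_orient x)\<^sup>2 = (norm (gap (fst x)))\<^sup>2 * (norm (gap (snd x)))\<^sup>2"
  unfolding gap_inner_def gap_orient_def cmod_power2 inner_complex_def
  by (simp add: power2_eq_square algebra_simps)

lemma gap_orient_nonzero:
  assumes "x \<in> conf_pairs" "gap_inner x = 0"
  shows "gap_orient x \<noteq> 0"
proof
  assume "gap_orient x = 0"
  then have "(norm (gap (fst x)))\<^sup>2 * (norm (gap (snd x)))\<^sup>2 = 0"
    using gap_inner_orient_norm[of x] assms(2) by simp
  moreover have "gap (fst x) \<noteq> 0" "gap (snd x) \<noteq> 0"
    using assms(1) gap_nonzero by auto
  ultimately show False by simp
qed

lemma direct_cross: "x \<in> conf_pairs \<Longrightarrow> direct (cross x) \<longleftrightarrow> \<not> direct x"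
  using gap_orient_nonzero[of x] by (cases "0 < gap_orient x"; cases "0 < gap_inner x") (auto simp: direct_def)

lemma direct_flip [simp]: "direct (flip x) = direct x"
  by (simp add: direct_def)

lemma matched_cross: "x \<in> conf_pairs \<Longrightarrow> matched (cross x) = matched x"
  by (simp add: matched_def direct_cross)

lemma matched_flip [simp]: "matched (flip x) = flip (matched x)"
  by (simp add: matched_def)

lemma codim_cross: "x \<in> conf_pairs \<Longrightarrow> codim (cross x) = codim x"
  by (simp add: codim_def matched_cross)

lemma codim_flip [simp]: "codim (flip x) = codim x"
  by (simp add: codim_def)

lemma gap_inner_matched: "0 \<le> gap_inner (matched x)"
  by (auto simp: matched_def direct_def split: if_splits)

lemma matched_in: "x \<in> conf_pairs \<Longrightarrow> matched x \<in> conf_pairs"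
  by (simp only: matched_def cross_in split: if_splits) simp

lemma fst_matched [simp]: "fst (matched x) = fst x"
  by (simp add: matched_def)

lemma snd_matched: "snd (matched x) = snd x \<or> snd (matched x) = prod.swap (snd x)"
  by (simp add: matched_def)

lemma clearance_flip [simp]: "clearance (flip x) = clearance x"
  by (simp add: clearance_def)

lemma detour_flip: "detour (flip x) s t = prod.swap (detour x s t)"
  by (simp add: detour_def route_def)

lemma unordered_pair_eq_cases:
  assumes "unordered_pair x0 x = unordered_pair x0 y"
  shows "y = x \<or> y = cross x \<or> y = flip x \<or> y = flip (cross x)"
proof -
  have "unordered x0 (fst y) = unordered x0 (fst x)" "unordered x0 (snd y) = unordered x0 (snd x)"
    using assms by (simp_all add: unordered_pair_def case_prod_unfold)
  then show ?thesis
    unfolding unordered_eq_iff cross_def flip_def prod_eq_iff[of y] by auto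
qed

text \<open>The closed conditions that hold at \<open>y\<close> already hold at \<open>x\<close>, and strict signs at \<open>x\<close> persist at \<open>y\<close>.\<close>
definition near :: "quad \<Rightarrow> quad \<Rightarrow> bool" where
  "near x y \<longleftrightarrow> (hits_fst y \<longrightarrow> hits_fst x) \<and> (hits_snd y \<longrightarrow> hits_snd x) \<and>
     (hits_fst (cross y) \<longrightarrow> hits_fst (cross x)) \<and> (hits_snd (cross y) \<longrightarrow> hits_snd (cross x)) \<and>
     (0 < gap_inner x \<longrightarrow> 0 < gap_inner y) \<and> (gap_inner x < 0 \<longrightarrow> gap_inner y < 0) \<and>
     (0 < gap_orient x \<longrightarrow> 0 < gap_orient y) \<and> (gap_orient x < 0 \<longrightarrow> gap_orient y < 0)"

lemma eventually_nhds_open: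
  assumes "open {y. P y}"
  shows "\<forall>\<^sub>F y in nhds x. P x \<longrightarrow> P y"
proof (cases "P x")
  case True
  then have "\<forall>\<^sub>F y in nhds x. y \<in> {y. P y}"
    using assms by (intro eventually_nhds_in_open) simp_all
  then show ?thesis by (rule eventually_mono) simp
qed simp

lemma open_not_hits:
  fixes f g :: "'a::topological_space \<Rightarrow> complex"
  assumes "continuous_on UNIV f" "continuous_on UNIV g"
  shows "open {y. \<not> hits (f y) (g y)}"
proof -
  have "closed ((\<lambda>y. cnj (f y) * g y) -` \<real>\<^sub>\<le>\<^sub>0)"
    by (intro closed_vimage closed_nonpos_Reals_complex continuous_intros assms)
  then have "open (- ((\<lambda>y. cnj (f y) * g y) -` \<real>\<^sub>\<le>\<^sub>0))" by (rule open_Compl)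
  moreover have "- ((\<lambda>y. cnj (f y) * g y) -` \<real>\<^sub>\<le>\<^sub>0) = {y. \<not> hits (f y) (g y)}"
    unfolding hits_def by auto
  ultimately show ?thesis by simp
qed

lemma eventually_near: "\<forall>\<^sub>F y in nhds x. near x y"
proof -
  have o: "open {y. \<not> hits_fst y}" "open {y. \<not> hits_snd y}" "open {y. \<not> hits_fst (cross y)}" "open {y. \<not> hits_snd (cross y)}"
    unfolding hits_fst_def hits_snd_def cross_simps fst_swap snd_swap
    by (rule open_not_hits; intro continuous_intros)+
  note h = o[THEN eventually_nhds_open[of _ x]]
  have c: "continuous_on UNIV gap_inner" "continuous_on UNIV gap_orient"
    unfolding gap_inner_def gap_orient_def gap_def by (intro continuous_intros)+
  have "\<forall>\<^sub>F y in nhds x. 0 < gap_inner x \<longrightarrow> 0 < gap_inner y" "\<forall>\<^sub>F y in nhds x. gap_inner x < 0 \<longrightarrow> gap_inner y < 0"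
    "\<forall>\<^sub>F y in nhds x. 0 < gap_orient x \<longrightarrow> 0 < gap_orient y" "\<forall>\<^sub>F y in nhds x. gap_orient x < 0 \<longrightarrow> gap_orient y < 0"
    by (rule eventually_nhds_open; intro open_Collect_less continuous_on_const c)+
  then show ?thesis
    using h unfolding near_def by eventually_elim blast
qed

lemma nhits_mono:
  assumes "hits_fst y \<longrightarrow> hits_fst x" "hits_snd y \<longrightarrow> hits_snd x"
  shows "nhits y \<le> nhits x" "nhits y = nhits x \<Longrightarrow> hits_fst y = hits_fst x \<and> hits_snd y = hits_snd x"
  using assms by (auto simp: nhits_def of_bool_def split: if_splits)

text \<open>If \<open>x\<close> is a tie and \<open>y\<close> is not, then \<open>codim y\<close> counts hits of one matching only and lacks the
  contribution of the tie, so it is strictly smaller. In all other cases the two numbers count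
  corresponding conditions, and equality means that no condition was lost.\<close>
lemma near_codim:
  assumes n: "near x y" and x: "x \<in> conf_pairs"
  shows "codim y \<le> codim x \<and> (codim y = codim x \<longrightarrow> direct y = direct x \<and>
    hits_fst (matched y) = hits_fst (matched x) \<and> hits_snd (matched y) = hits_snd (matched x))"
proof -
  have m: "nhits y \<le> nhits x" "nhits y = nhits x \<Longrightarrow> hits_fst y = hits_fst x \<and> hits_snd y = hits_snd x"
    "nhits (cross y) \<le> nhits (cross x)"
    "nhits (cross y) = nhits (cross x) \<Longrightarrow> hits_fst (cross y) = hits_fst (cross x) \<and> hits_snd (cross y) = hits_snd (cross x)"
    using nhits_mono[of y x] nhits_mono[of "cross y" "cross x"] n unfolding near_def by blast+
  consider "0 < gap_inner x" | "gap_inner x < 0" | "gap_inner x = 0" by linarith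
  then show ?thesis
  proof cases
    case 1
    then have "0 < gap_inner y" using n by (simp add: near_def)
    with 1 show ?thesis using m by (simp add: codim_def direct_def matched_def)
  next
    case 2
    then have "gap_inner y < 0" using n by (simp add: near_def)
    with 2 show ?thesis using m by (simp add: codim_def direct_def matched_def)
  next
    case 3
    show ?thesis
    proof (cases "gap_inner y = 0")
      case True
      have o: "(0 < gap_orient y) = (0 < gap_orient x)"
        using gap_orient_nonzero[OF x 3] n unfolding near_def by linarith
      have le: "codim y \<le> codim x" using True 3 m by (simp add: codim_def)
      have "direct y = direct x \<and> hits_fst (matched y) = hits_fst (matched x) \<and> hits_snd (matched y) = hits_snd (matched x)"
        if "codim y = codim x"
      proof -
        have eq: "nhits y = nhits x" "nhits (cross y) = nhits (cross x)"
          using that True 3 m(1,3) by (simp_all add: codim_def)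
        then have "direct y = direct x" using True 3 o by (simp add: direct_def)
        then show ?thesis using m(2)[OF eq(1)] m(4)[OF eq(2)] by (simp add: matched_def)
      qed
      with le show ?thesis by blast
    next
      case False
      have "nhits (matched y) \<le> nhits x + nhits (cross x)"
        using m(1,3) by (simp add: matched_def)
      then have "codim y < codim x" using False 3 by (simp add: codim_def)
      then show ?thesis by simp
    qed
  qed
qed

text \<open>Three hits force all four points onto one line through \<open>0\<close>, and the two differences are then parallel
  and orthogonal at once, although neither of them vanishes.\<close>
lemma tie_not_three_hits:
  assumes x: "x \<in> conf_pairs" and gap_inner: "gap_inner x = 0"
  shows "\<not> (hits_fst x \<and> hits_fst (cross x) \<and> hits_snd (cross x))"
proof
  assume h: "hits_fst x \<and> hits_fst (cross x) \<and> hits_snd (cross x)"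
  define a a' b b' where "a = fst (fst x)" and "a' = snd (fst x)" and "b = fst (snd x)" and "b' = snd (snd x)"
  note d = a_def[symmetric] a'_def[symmetric] b_def[symmetric] b'_def[symmetric]
  have nz: "a \<noteq> 0" "a' \<noteq> 0" "b \<noteq> 0" "b' \<noteq> 0" "a \<noteq> a'" "b \<noteq> b'"
    using x by (auto simp: ordered_conf_def a_def a'_def b_def b'_def)
  have h': "hits a b" "hits a b'" "hits a' b"
    using h by (simp_all add: hits_fst_def hits_snd_def d)
  obtain r1 where r1: "r1 > 0" "b = - (of_real r1 * a)" using h'(1) nz(1,3) by (rule hitsE)
  obtain r2 where r2: "r2 > 0" "b' = - (of_real r2 * a)" using h'(2) nz(1,4) by (rule hitsE)
  obtain r3 where r3: "r3 > 0" "b = - (of_real r3 * a')" using h'(3) nz(2,3) by (rule hitsE)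
  have "of_real r3 * a' = of_real r1 * a" using r1(2) r3(2) by simp
  moreover define k where "k = r1 / r3"
  ultimately have "of_real r3 * a' = of_real (r3 * k) * a" using r3(1) by simp
  then have "of_real r3 * a' = of_real r3 * (of_real k * a)" by (simp only: of_real_mult mult.assoc)
  then have a': "a' = of_real k * a" using r3(1) by simp
  have "gap (fst x) = of_real (1 - k) * a" "gap (snd x) = of_real (r2 - r1) * a"
    unfolding gap_def d a' by (simp_all add: r1(2) r2(2) algebra_simps)
  then have "gap_inner x = (1 - k) * (r2 - r1) * (norm a)\<^sup>2"
    unfolding gap_inner_def by (simp only: inner_complex_def cmod_power2) (simp add: power2_eq_square algebra_simps)
  then have "1 - k = 0 \<or> r2 - r1 = 0" using gap_inner nz(1) by simp
  then show False
  proof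
    assume "1 - k = 0"
    then show False using nz(5) a' by simp
  next
    assume "r2 - r1 = 0"
    then show False using nz(6) r1(2) r2(2) by simp
  qed
qed

lemma codim_le_3: "x \<in> conf_pairs \<Longrightarrow> codim x \<le> 3"
proof -
  assume x: "x \<in> conf_pairs"
  have n2: "nhits y \<le> 2" for y by (simp add: nhits_def)
  show "codim x \<le> 3"
  proof (cases "gap_inner x = 0")
    case False
    then show ?thesis using n2[of "matched x"] by (simp add: codim_def)
  next
    case True
    have "\<not> (hits_fst x \<and> hits_fst (cross x) \<and> hits_snd (cross x))" "\<not> (hits_snd x \<and> hits_snd (cross x) \<and> hits_fst (cross x))"
      "\<not> (hits_fst (cross x) \<and> hits_fst x \<and> hits_snd x)" "\<not> (hits_snd (cross x) \<and> hits_snd x \<and> hits_fst x)"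
      using tie_not_three_hits[of x] tie_not_three_hits[of "flip x"] tie_not_three_hits[of "cross x"]
        tie_not_three_hits[of "flip (cross x)"] x True by simp_all
    then have "nhits x + nhits (cross x) \<le> 2" unfolding nhits_def of_bool_def by auto
    then show ?thesis using True by (simp add: codim_def)
  qed
qed

lemma tendsto_route:
  assumes X: "(X \<longlongrightarrow> x) F" and S: "(S \<longlongrightarrow> s) F" and T: "(T \<longlongrightarrow> t) F"
    and nz: "fst (snd x) \<noteq> 0" "snd (snd x) \<noteq> 0"
  shows "((\<lambda>p. route h h' (X p) (S p) (T p)) \<longlongrightarrow> route h h' x s t) F"
  unfolding route_def bend_def clearance_def gap_def
  by (intro tendsto_intros tendsto_min X S T nz)

text \<open>On a stratum the selected matching and its hits are locally constant by \<open>near_codim\<close>, so locally the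
  function is given by one continuous formula.\<close>
lemma continuous_on_detour_matched:
  fixes j :: nat
  defines "S \<equiv> {x \<in> conf_pairs. codim x = j}"
  shows "continuous_on ((S \<times> {0..1::real}) \<times> {0..1::real}) (\<lambda>((x, s), t). detour (matched x) s t)"
  unfolding continuous_on
proof
  fix p assume p: "p \<in> (S \<times> {0..1::real}) \<times> {0..1::real}"
  define x where "x = fst (fst p)"
  have x: "x \<in> conf_pairs" "codim x = j" using p by (auto simp: x_def S_def)
  let ?F = "at p within (S \<times> {0..1}) \<times> {0..1}"
  \<comment> \<open>The matching with the label selected at \<open>x\<close>; unlike \<open>matched\<close> it is continuous everywhere.\<close>
  define m where "m y = (if direct x then y else cross y)" for y
  have mx: "m x = matched x" by (simp add: m_def matched_def)
  have lim: "((\<lambda>q. q) \<longlongrightarrow> p) ?F" by (rule tendsto_ident_at)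
  have limx: "((\<lambda>q. fst (fst q)) \<longlongrightarrow> x) ?F"
    unfolding x_def by (intro tendsto_intros lim)
  have limm: "((\<lambda>q. m (fst (fst q))) \<longlongrightarrow> m x) ?F"
    unfolding m_def cross_def prod.swap_def by (cases "direct x") (auto intro!: tendsto_intros limx)
  have "matched x \<in> conf_pairs" using x(1) by (rule matched_in)
  then have nz: "fst (snd (m x)) \<noteq> 0" "snd (snd (m x)) \<noteq> 0"
    unfolding mx by (auto simp: ordered_conf_def)
  have lim2: "((\<lambda>q. route (hits_fst (matched x)) (hits_snd (matched x)) (m (fst (fst q))) (snd (fst q)) (snd q))
      \<longlongrightarrow> route (hits_fst (matched x)) (hits_snd (matched x)) (m x) (snd (fst p)) (snd p)) ?F"
    by (rule tendsto_route[OF limm _ _ nz]; intro tendsto_intros lim)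
  have "\<forall>\<^sub>F q in ?F. near x (fst (fst q))"
    using eventually_near limx unfolding filterlim_iff by blast
  moreover have "\<forall>\<^sub>F q in ?F. q \<in> (S \<times> {0..1}) \<times> {0..1}"
    by (simp add: eventually_at_filter)
  ultimately have "\<forall>\<^sub>F q in ?F. route (hits_fst (matched x)) (hits_snd (matched x)) (m (fst (fst q))) (snd (fst q)) (snd q)
      = (\<lambda>((x, s), t). detour (matched x) s t) q"
  proof eventually_elim
    case (elim q)
    define y where "y = fst (fst q)"
    have "codim y = codim x" using elim(2) x(2) by (auto simp: S_def y_def)
    then have "direct y = direct x" "hits_fst (matched y) = hits_fst (matched x)" "hits_snd (matched y) = hits_snd (matched x)"
      using near_codim[OF elim(1) x(1)] unfolding y_def[symmetric] by blast+
    moreover from this(1) have "m y = matched y" by (simp add: m_def matched_def)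
    ultimately show ?case
      by (simp only: case_prod_unfold detour_def y_def[symmetric])
  qed
  from tendsto_cong[OF this] lim2
  show "((\<lambda>((x, s), t). detour (matched x) s t) \<longlongrightarrow> (\<lambda>((x, s), t). detour (matched x) s t) p) ?F"
    unfolding mx by (simp add: case_prod_unfold detour_def x_def)
qed

definition line :: "complex \<times> complex \<Rightarrow> complex \<times> complex \<Rightarrow> real \<Rightarrow> complex \<times> complex" where
  "line p q t = (1 - t) *\<^sub>R p + t *\<^sub>R q"

text \<open>The distance of unordered pairs, as seen on ordered representatives.\<close>
definition udist :: "complex \<times> complex \<Rightarrow> complex \<times> complex \<Rightarrow> real" where
  "udist p q = min (dist p q) (dist p (prod.swap q))"

lemma dist_swap_swap [simp]: "dist (prod.swap p) (prod.swap q) = dist p q"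
  by (simp add: dist_prod_def add.commute)

lemma dist_swap_left: "dist (prod.swap p) q = dist p (prod.swap q)"
  using dist_swap_swap[of p "prod.swap q"] by simp

lemma udist_swap [simp]: "udist (prod.swap p) q = udist p q" "udist p (prod.swap q) = udist p q"
  unfolding udist_def dist_swap_left swap_swap by (simp_all only: min.commute)

lemma udist_eq_dist: "0 \<le> gap_inner (p, q) \<Longrightarrow> udist p q = dist p q"
  unfolding udist_def by (intro min_absorb1 dist_le_dist_swap)

text \<open>Strict convexity of the Euclidean norm: a point that divides the distance from \<open>p\<close> to \<open>q\<close> in the ratio
  \<open>t\<close> to \<open>1 - t\<close> lies on one of the segments given by the shortest matchings.\<close>
lemma udist_geodesic_point:
  assumes t: "0 \<le> t" "t \<le> 1" and dpr: "udist p r = t * udist p q" and drq: "udist r q = (1 - t) * udist p q"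
  obtains r' q' where "r' = r \<or> r' = prod.swap r" "q' = q \<or> q' = prod.swap q"
    "dist p q' = udist p q" "r' = line p q' t"
proof -
  have ex: "\<exists>b'. (b' = b \<or> b' = prod.swap b) \<and> dist a b' = udist a b" for a b
  proof (cases "dist a b \<le> dist a (prod.swap b)")
    case True
    then show ?thesis by (intro exI[of _ b]) (simp add: udist_def min_def)
  next
    case False
    then show ?thesis by (intro exI[of _ "prod.swap b"]) (simp add: udist_def min_def)
  qed
  obtain r' where r': "r' = r \<or> r' = prod.swap r" "dist p r' = udist p r" using ex by blast
  have "udist r' q = udist r q" using r'(1) by (elim disjE) simp_all
  then obtain q' where q': "q' = q \<or> q' = prod.swap q" "dist r' q' = udist r q" using ex[of q r'] by auto
  let ?D = "udist p q"
  have "dist p q' \<le> dist p r' + dist r' q'" by (rule dist_triangle)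
  also have "\<dots> = ?D" unfolding r'(2) q'(2) dpr drq by (simp add: algebra_simps)
  finally have le: "dist p q' \<le> ?D" .
  have "?D \<le> dist p q'" using q'(1) by (auto simp: udist_def)
  with le have D: "dist p q' = ?D" by simp
  have r'D: "norm (p - r') = t * ?D" "norm (r' - q') = (1 - t) * ?D"
    using r'(2) q'(2) dpr drq by (simp_all add: dist_norm)
  have "dist p q' = dist p r' + dist r' q'"
    unfolding D r'(2) q'(2) dpr drq by (simp add: algebra_simps)
  then have eq: "(t * ?D) *\<^sub>R (r' - q') = ((1 - t) * ?D) *\<^sub>R (p - r')"
    unfolding dist_triangle_eq r'D .
  have "r' = line p q' t"
  proof (cases "?D = 0")
    case True
    then have "p = q'" "p = r'" using D r'D(1) by simp_all
    then show ?thesis by (simp add: line_def flip: scaleR_left_distrib)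
  next
    case False
    have "?D *\<^sub>R (t *\<^sub>R (r' - q')) = ?D *\<^sub>R ((1 - t) *\<^sub>R (p - r'))"
      using eq by (simp add: mult.commute)
    then have "t *\<^sub>R (r' - q') = (1 - t) *\<^sub>R (p - r')"
      by (rule scaleR_left_imp_eq[OF False])
    then show ?thesis by (simp add: line_def algebra_simps)
  qed
  with r'(1) q'(1) D show thesis by (intro that)
qed

text \<open>In a tie the two geodesics agree in their midpoints but have different gaps; expanding the squares shows
  that a point on one of them is too far from any point on the other one for both to lie at interior
  times of one geodesic.\<close>
lemma dist_crossed_lines:
  assumes "gap_inner (p, q) = 0"
  shows "(dist (line p (prod.swap q) t) (line p q t'))\<^sup>2 = ((t - t') * dist p q)\<^sup>2 + 2 * (t * t') * (norm (gap q))\<^sup>2"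
    and "(dist (line p (prod.swap q) t) (prod.swap (line p q t')))\<^sup>2 =
      ((t - t') * dist p q)\<^sup>2 + 2 * ((1 - t) * (1 - t')) * (norm (gap p))\<^sup>2"
proof -
  have gap_inner: "Re (gap p) * Re (gap q) + Im (gap p) * Im (gap q) = 0"
    using assms by (simp add: gap_inner_def inner_complex_def)
  have 1: "(dist (line p (prod.swap q) t) (line p q t'))\<^sup>2 =
      ((t - t') * dist p q)\<^sup>2 + 2 * (t * t') * (norm (gap q))\<^sup>2
      + 2 * t * (t - t') * (Re (gap p) * Re (gap q) + Im (gap p) * Im (gap q))"
    by (simp add: dist_prod_def line_def gap_def dist_norm cmod_power2 power_mult_distrib)
      (simp add: power2_eq_square algebra_simps)
  then show eq: "(dist (line p (prod.swap q) t) (line p q t'))\<^sup>2 = ((t - t') * dist p q)\<^sup>2 + 2 * (t * t') * (norm (gap q))\<^sup>2"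
    unfolding gap_inner by simp
  have "gap_inner (line p (prod.swap q) t, line p q t') = (1 - t) * (1 - t') * (norm (gap p))\<^sup>2 - t * t' * (norm (gap q))\<^sup>2
      + (t' - t) * (Re (gap p) * Re (gap q) + Im (gap p) * Im (gap q))"
    by (simp add: gap_inner_def line_def gap_def inner_complex_def cmod_power2)
      (simp add: power2_eq_square algebra_simps)
  then have "gap_inner (line p (prod.swap q) t, line p q t') = (1 - t) * (1 - t') * (norm (gap p))\<^sup>2 - t * t' * (norm (gap q))\<^sup>2"
    unfolding gap_inner by simp
  then show "(dist (line p (prod.swap q) t) (prod.swap (line p q t')))\<^sup>2 =
      ((t - t') * dist p q)\<^sup>2 + 2 * ((1 - t) * (1 - t')) * (norm (gap p))\<^sup>2"
    unfolding dist_swap_gap eq by simp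
qed

lemma hits_imp_line_leaves:
  assumes x: "x \<in> conf_pairs" and h: "0 < nhits x"
  obtains t where "0 < t" "t < 1" "line (fst x) (snd x) t \<notin> ordered_conf"
proof -
  have nz: "fst (fst x) \<noteq> 0" "snd (fst x) \<noteq> 0" "fst (snd x) \<noteq> 0" "snd (snd x) \<noteq> 0"
    using x by (auto simp: ordered_conf_def)
  have "hits_fst x \<or> hits_snd x" using h by (auto simp: nhits_def)
  then show thesis
  proof
    assume "hits_fst x"
    then obtain t where "0 < t" "t < 1" "of_real (1 - t) * fst (fst x) + of_real t * fst (snd x) = 0"
      unfolding hits_fst_def using nz(1,3) by (rule hits_imp_segment_zero)
    then show thesis by (intro that) (auto simp: line_def ordered_conf_def case_prod_unfold scaleR_conv_of_real)
  next
    assume "hits_snd x"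
    then obtain t where "0 < t" "t < 1" "of_real (1 - t) * snd (fst x) + of_real t * snd (snd x) = 0"
      unfolding hits_snd_def using nz(2,4) by (rule hits_imp_segment_zero)
    then show thesis by (intro that) (auto simp: line_def ordered_conf_def case_prod_unfold scaleR_conv_of_real)
  qed
qed

text \<open>In a tie a matching with hits is selected only if the other one has hits, too.\<close>
lemma tie_matched_hits: "gap_inner x = 0 \<Longrightarrow> 0 < nhits (matched x) \<Longrightarrow> 0 < nhits (cross (matched x))"
  by (auto simp: matched_def direct_def split: if_splits)

lemma swap_in [simp]: "prod.swap p \<in> ordered_conf \<longleftrightarrow> p \<in> ordered_conf"
  by (auto simp: ordered_conf_def)

text \<open>Let \<open>r\<close> be a geodesic in \<open>X\<close>, and suppose that the selected matching has a hit. At the time of the hit,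
  \<open>r\<close> cannot be on the straight motion of that matching, so it is on that of the other one, and there
  is a tie. Then the other matching has a hit, too, and at that time \<open>r\<close> is on the motion of the selected
  one. But no geodesic passes through points of both motions at interior times.\<close>
lemma geodesic_imp_no_hits:
  assumes x: "x \<in> conf_pairs" and r: "\<And>t. t \<in> {0..1} \<Longrightarrow> r t \<in> ordered_conf"
    and rp: "\<And>t. t \<in> {0..1} \<Longrightarrow> udist (fst x) (r t) = t * udist (fst x) (snd x)"
    and rq: "\<And>t. t \<in> {0..1} \<Longrightarrow> udist (r t) (snd x) = (1 - t) * udist (fst x) (snd x)"
    and rr: "\<And>t t'. t \<in> {0..1} \<Longrightarrow> t' \<in> {0..1} \<Longrightarrow> udist (r t) (r t') = \<bar>t - t'\<bar> * udist (fst x) (snd x)"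
  shows "nhits (matched x) = 0"
proof (rule ccontr)
  assume "nhits (matched x) \<noteq> 0"
  then have n: "0 < nhits (matched x)" by simp
  define p q where "p = fst x" and "q = snd (matched x)"
  have y: "matched x = (p, q)" by (simp add: p_def q_def prod_eq_iff)
  have yin: "matched x \<in> conf_pairs" by (rule matched_in[OF x])
  have ud: "udist a (snd x) = udist a q" for a
    using snd_matched[of x] unfolding q_def by (elim disjE) simp_all
  have D: "udist p q = dist p q" using gap_inner_matched[of x] unfolding y by (rule udist_eq_dist)
  have on_line: "\<exists>r' q'. (r' = r t \<or> r' = prod.swap (r t)) \<and> (q' = q \<or> q' = prod.swap q) \<and> dist p q' = dist p q \<and> r' = line p q' t"
    if t: "0 < t" "t < 1" for t
  proof -
    have t': "t \<in> {0..1}" "0 \<le> t" "t \<le> 1" using t by auto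
    have u: "udist p (r t) = t * udist p q" "udist (r t) q = (1 - t) * udist p q"
      using rp[OF t'(1)] rq[OF t'(1)] unfolding ud p_def by simp_all
    obtain r' q' where "r' = r t \<or> r' = prod.swap (r t)" "q' = q \<or> q' = prod.swap q"
      "dist p q' = udist p q" "r' = line p q' t"
      by (rule udist_geodesic_point[OF t'(2,3) u])
    then show ?thesis unfolding D by (intro exI[of _ r'] exI[of _ q'] conjI)
  qed
  have out: "\<exists>r'. (r' = r t \<or> r' = prod.swap (r t)) \<and> dist p (prod.swap q') = dist p q \<and> r' = line p (prod.swap q') t"
    if t: "0 < t" "t < 1" and q': "q' = q \<or> q' = prod.swap q" and l: "line p q' t \<notin> ordered_conf" for t q'
  proof -
    obtain r' q'' where r': "r' = r t \<or> r' = prod.swap (r t)" "q'' = q \<or> q'' = prod.swap q"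
      "dist p q'' = dist p q" "r' = line p q'' t"
      using on_line[OF t] by blast
    have "r t \<in> ordered_conf" using r t by simp
    then have "r' \<in> ordered_conf" using r'(1) by (elim disjE) simp_all
    then have "q'' \<noteq> q'" using l r'(4) by blast
    then have "q'' = prod.swap q'" using r'(2) q' by (elim disjE) simp_all
    then show ?thesis using r' by blast
  qed
  obtain t where t: "0 < t" "t < 1" "line p q t \<notin> ordered_conf"
    using hits_imp_line_leaves[OF yin n] unfolding y fst_conv snd_conv .
  obtain a where a: "a = r t \<or> a = prod.swap (r t)" "dist p (prod.swap q) = dist p q" "a = line p (prod.swap q) t"
    using out[OF t(1,2) disjI1[OF refl] t(3)] by (elim exE conjE)
  have ip0: "gap_inner (p, q) = 0" using dist_swap_gap[of p q] a(2) by simp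
  then have "gap_inner x = 0" unfolding y[symmetric] by (simp add: matched_def split: if_splits)
  then have nc: "0 < nhits (cross (matched x))" using n by (rule tie_matched_hits)
  have cin: "cross (matched x) \<in> conf_pairs" using yin by simp
  obtain t' where t': "0 < t'" "t' < 1"
      "line (fst (cross (matched x))) (snd (cross (matched x))) t' \<notin> ordered_conf"
    by (rule hits_imp_line_leaves[OF cin nc])
  have l': "line p (prod.swap q) t' \<notin> ordered_conf"
    using t'(3) unfolding y cross_simps fst_conv snd_conv .
  obtain b where b: "b = r t' \<or> b = prod.swap (r t')" "b = line p q t'"
    using out[OF t'(1,2) disjI2[OF refl] l'] unfolding swap_swap by (elim exE conjE)
  have "udist a b = udist (r t) (r t')" using a(1) b(1) by (elim disjE) simp_all
  also have "\<dots> = \<bar>t - t'\<bar> * udist p q" using rr[of t t'] t t' ud[of p] by (simp add: p_def)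
  finally have eq: "udist a b = \<bar>t - t'\<bar> * dist p q" unfolding D .
  have g: "norm (gap p) > 0" "norm (gap q) > 0" using yin gap_nonzero unfolding y by auto
  have "(\<bar>t - t'\<bar> * dist p q)\<^sup>2 = ((t - t') * dist p q)\<^sup>2" by (simp add: power_mult_distrib)
  moreover have "2 * (t * t') * (norm (gap q))\<^sup>2 > 0" "2 * ((1 - t) * (1 - t')) * (norm (gap p))\<^sup>2 > 0"
    using g t t' by simp_all
  ultimately have "(dist a b)\<^sup>2 > (\<bar>t - t'\<bar> * dist p q)\<^sup>2" "(dist a (prod.swap b))\<^sup>2 > (\<bar>t - t'\<bar> * dist p q)\<^sup>2"
    unfolding a(3) b(2) dist_crossed_lines[OF ip0] by linarith+
  then have "dist a b > \<bar>t - t'\<bar> * dist p q" "dist a (prod.swap b) > \<bar>t - t'\<bar> * dist p q"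
    by (auto intro: power2_less_imp_less)
  then show False using eq unfolding udist_def by linarith
qed

lemma udist_line:
  assumes "0 \<le> gap_inner (p, q)" "t \<in> {0..1}" "t' \<in> {0..1}"
  shows "udist (line p q t) (line p q t') = \<bar>t - t'\<bar> * dist p q"
proof -
  have "gap_inner (line p q t, line p q t') = (1 - t) * (1 - t') * (norm (gap p))\<^sup>2 + t * t' * (norm (gap q))\<^sup>2
      + ((1 - t) * t' + t * (1 - t')) * gap_inner (p, q)"
    unfolding gap_inner_def by (simp add: line_def gap_def inner_complex_def cmod_power2)
      (simp add: power2_eq_square algebra_simps)
  also have "\<dots> \<ge> 0" using assms by (intro add_nonneg_nonneg mult_nonneg_nonneg) auto
  finally have "udist (line p q t) (line p q t') = dist (line p q t) (line p q t')" by (rule udist_eq_dist)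
  also have "line p q t - line p q t' = (t - t') *\<^sub>R (q - p)" by (simp add: line_def algebra_simps)
  then have "dist (line p q t) (line p q t') = \<bar>t - t'\<bar> * dist p q"
    by (simp add: dist_norm norm_minus_commute)
  finally show ?thesis .
qed

section \<open>The upper bound\<close>

text \<open>Together with \<open>path_length_ge\<close> this squeezes the length of a path between the distance of its endpoints and
  its Lipschitz constant. For the detours both tend to the length of the geodesic.\<close>
lemma path_length_le:
  assumes L: "\<And>t t'. t \<in> {0..1} \<Longrightarrow> t' \<in> {0..1} \<Longrightarrow> mdist Z (\<gamma> t) (\<gamma> t') \<le> \<bar>t - t'\<bar> * K" and K: "0 \<le> K"
  shows "path_length Z \<gamma> \<le> ereal K"
  unfolding path_length_def
proof (rule SUP_least)
  fix nt assume "nt \<in> {(n :: nat, t). mono_on {..n} t \<and> t ` {..n} \<subseteq> {0..1::real}}"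
  then obtain n t where nt: "nt = (n, t)" "mono_on {..n} t" "t ` {..n} \<subseteq> {0..1::real}" by auto
  have t: "t i \<in> {0..1}" if "i \<le> n" for i using nt(3) that by (auto simp: image_subset_iff)
  have "(\<Sum>i<n. mdist Z (\<gamma> (t i)) (\<gamma> (t (Suc i)))) \<le> (\<Sum>i<n. (t (Suc i) - t i) * K)"
  proof (rule sum_mono)
    fix i assume i: "i \<in> {..<n}"
    then have "t i \<le> t (Suc i)" by (intro monotone_onD[OF nt(2)]) auto
    then have "\<bar>t i - t (Suc i)\<bar> = t (Suc i) - t i" by simp
    then show "mdist Z (\<gamma> (t i)) (\<gamma> (t (Suc i))) \<le> (t (Suc i) - t i) * K"
      using L[OF t t, of i "Suc i"] i by simp
  qed
  also have "\<dots> = (t n - t 0) * K"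
    by (simp add: sum_lessThan_telescope flip: sum_distrib_right)
  also have "\<dots> \<le> 1 * K"
    using t[of n] t[of 0] K by (intro mult_right_mono) auto
  finally show "(case nt of (n, t) \<Rightarrow> ereal (\<Sum>i<n. mdist Z (\<gamma> (t i)) (\<gamma> (t (Suc i))))) \<le> ereal K"
    by (simp add: nt(1))
qed

lemma path_length_ge: "ereal (mdist Z (\<gamma> 0) (\<gamma> 1)) \<le> path_length Z \<gamma>"
proof -
  have "(1::nat, real) \<in> {(n :: nat, t). mono_on {..n} t \<and> t ` {..n} \<subseteq> {0..1::real}}"
    by (auto intro!: monotone_onI)
  from SUP_upper[OF this, of "\<lambda>(n, t). ereal (\<Sum>i<n. mdist Z (\<gamma> (t i)) (\<gamma> (t (Suc i))))"]
  show ?thesis by (simp add: path_length_def)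
qed

text \<open>By \<open>near_codim\<close> the codimension is upper semicontinuous, so a stratum is the difference of two open
  sets.\<close>
lemma locally_compact_codim_stratum: "locally_compact_space (top_of_set {x \<in> conf_pairs. codim x = j})"
proof -
  have op: "open {x \<in> conf_pairs. codim x \<le> k}" for k
    unfolding open_subopen[of "{x \<in> conf_pairs. codim x \<le> k}"]
  proof
    fix x assume x: "x \<in> {x \<in> conf_pairs. codim x \<le> k}"
    obtain U where U: "open U" "x \<in> U" "\<And>y. y \<in> U \<Longrightarrow> near x y"
      using eventually_near[of x] unfolding eventually_nhds by blast
    have "open (U \<inter> conf_pairs)" using U(1) open_Times[OF open_ordered_conf open_ordered_conf] by (rule open_Int)
    moreover have "codim y \<le> k" if "y \<in> U" for y
      using near_codim[OF U(3)[OF that]] x by auto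
    ultimately show "\<exists>T. open T \<and> x \<in> T \<and> T \<subseteq> {x \<in> conf_pairs. codim x \<le> k}"
      using U(2) x by (intro exI[of _ "U \<inter> conf_pairs"]) auto
  qed
  have op': "open {x \<in> conf_pairs. codim x < j}"
  proof (cases j)
    case (Suc k)
    then show ?thesis using op[of k] by (simp add: less_Suc_eq_le)
  qed simp
  let ?O = "{x \<in> conf_pairs. codim x \<le> j}" and ?C = "- {x \<in> conf_pairs. codim x < j}"
  have "locally_compact_space (top_of_set ?O)"
    using op by (intro locally_compact_space_open_subset) (simp_all add: locally_compact_space_euclidean)
  moreover have "closedin (top_of_set ?O) (?O \<inter> ?C)"
    using op' by (intro closedin_closed_Int closed_Compl)
  ultimately have "locally_compact_space (subtopology (top_of_set ?O) (?O \<inter> ?C))"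
    by (rule locally_compact_space_closed_subset)
  moreover have "subtopology (top_of_set ?O) (?O \<inter> ?C) = top_of_set {x \<in> conf_pairs. codim x = j}"
    unfolding subtopology_subtopology by (rule arg_cong[where f = top_of_set]) auto
  ultimately show ?thesis by simp
qed

context
  fixes x0 :: "real ^ 2"
begin

lemma codim_stratum_saturated:
  "{x \<in> conf_pairs. codim x = j} = {x \<in> conf_pairs. unordered_pair x0 x \<in> unordered_pair x0 ` {x \<in> conf_pairs. codim x = j}}"
proof -
  have "codim x = j" if x: "x \<in> conf_pairs" and y: "y \<in> conf_pairs" "codim y = j" "unordered_pair x0 x = unordered_pair x0 y" for x y
    using unordered_pair_eq_cases[OF y(3)[symmetric]] codim_cross[OF y(1)] y(2) by (elim disjE) simp_all
  then show ?thesis by blast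
qed

text \<open>The rule sends a pair to the image in the completion of the detours of the selected matching of any
  ordered representative. Exchanging the points at one end exchanges the two matchings, and exchanging
  them at both ends swaps the motion, so the choice of the representative does not matter.\<close>
lemma ngmpr_codim_stratum:
  "\<exists>\<Phi>. ngmpr (conf_metric x0) (unordered_pair x0 ` {x \<in> conf_pairs. codim x = j}) \<Phi>"
proof -
  define S where "S = {x \<in> conf_pairs. codim x = j}"
  define E where "E = unordered_pair x0 ` S"
  define Y where "Y = mcompletion (conf_metric x0)"
  define i where "i = to_mcompletion (conf_metric x0)"
  define X' where "X' = submetric Y (i ` mspace (conf_metric x0))"
  obtain e where e: "continuous_map euclidean (mtopology_of Y) e"
    "\<And>p. p \<in> ordered_conf \<Longrightarrow> e p = i (unordered x0 p)"
    "\<And>p q. mdist Y (e p) (e q) = min (dist p q) (dist p (prod.swap q))"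
    "\<And>p. e (prod.swap p) = e p"
    by (rule completion_extension[of x0, folded Y_def i_def]) (rule that)
  have ud: "mdist Y (e p) (e q) = udist p q" for p q unfolding udist_def by (rule e(3))
  have sat: "S = {x \<in> conf_pairs. unordered_pair x0 x \<in> E}"
    unfolding E_def S_def by (rule codim_stratum_saturated)
  have Esub: "E \<subseteq> mspace (conf_metric x0) \<times> mspace (conf_metric x0)"
    unfolding E_def unordered_pair_image[symmetric] S_def by (rule image_mono) blast
  define F where "F x s t = e (detour (matched x) s t)" for x s t
  \<comment> \<open>An ordered representative. Its choice need not be continuous, since \<open>F\<close> does not depend on it.\<close>
  define sel where "sel z = (SOME x. x \<in> conf_pairs \<and> unordered_pair x0 x = z)" for z
  define \<Phi> where "\<Phi> z = restrict (\<lambda>s. restrict (\<lambda>t. F (sel z) s t) {0..1}) {0..1}" for z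
  have F_eq: "F y = F x" if "x \<in> conf_pairs" "unordered_pair x0 x = unordered_pair x0 y" for x y
    using unordered_pair_eq_cases[OF that(2)] matched_cross[OF that(1)]
    by (elim disjE) (simp_all add: F_def fun_eq_iff detour_flip e(4))
  have \<Phi>_F: "\<Phi> (unordered_pair x0 x) s t = F x s t" if x: "x \<in> conf_pairs" and st: "s \<in> {0..1}" "t \<in> {0..1}" for x s t
  proof -
    have "sel (unordered_pair x0 x) \<in> conf_pairs \<and> unordered_pair x0 (sel (unordered_pair x0 x)) = unordered_pair x0 x"
      unfolding sel_def by (rule someI[of "\<lambda>y. y \<in> conf_pairs \<and> unordered_pair x0 y = unordered_pair x0 x" x]) (simp add: x)
    then have "F (sel (unordered_pair x0 x)) = F x"
      by (intro F_eq[OF x]) (rule sym, rule conjunct2)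
    then show ?thesis using st by (simp add: \<Phi>_def)
  qed
  have \<Phi>_ext: "\<Phi> z \<in> extensional {0..1}" "s \<in> {0..1} \<Longrightarrow> \<Phi> z s \<in> extensional {0..1}" for z s
    by (simp_all add: \<Phi>_def)
  have "continuous_map (top_of_set ((S \<times> {0..1}) \<times> {0..1})) euclidean (\<lambda>((x, s), t). detour (matched x) s t)"
    using continuous_on_detour_matched[of j] unfolding S_def by simp
  from continuous_map_compose[OF this e(1)]
  have contF: "continuous_map (top_of_set ((S \<times> {0..1}) \<times> {0..1})) (mtopology_of Y) (\<lambda>((x, s), t). F x s t)"
    by (simp add: o_def case_prod_unfold F_def)
  have contF': "continuous_map (top_of_set ((S \<times> {0..1}) \<times> {0..1})) (mtopology_of Y)
      (\<lambda>((x, s), t). \<Phi> (unordered_pair x0 x) s t)"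
    by (rule continuous_map_eq[OF contF]) (auto simp: \<Phi>_F S_def)
  have "continuous_map (prod_topology (top_of_set S) unit_interval) (path_space (mtopology_of Y))
      (\<lambda>(x, s). \<Phi> (unordered_pair x0 x) s)"
    unfolding continuous_map_path_space_iff using contF' \<Phi>_ext(2) by (simp add: case_prod_unfold)
  then have "continuous_map (top_of_set S) (path_space (path_space (mtopology_of Y))) (\<lambda>x. \<Phi> (unordered_pair x0 x))"
    unfolding continuous_map_path_space_iff[where W = "path_space (mtopology_of Y)"] using \<Phi>_ext(1) by simp
  then have "continuous_map (top_of_set S) (path_space (path_space (mtopology_of Y))) (\<Phi> \<circ> unordered_pair x0)"
    by (simp add: o_def)
  then have cont\<Phi>: "continuous_map (subtopology (pair_topology x0) E) (path_space (path_space (mtopology_of Y))) \<Phi>"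
    using quotient_map_unordered_pair(1)[OF sat Esub] by (rule continuous_compose_quotient_map[rotated])
  have near: "near_geodesic Y X' (i A) (i B) (\<Phi> (A, B)) \<and>
     ((\<exists>\<gamma>. geodesic X' (i A) (i B) \<gamma>) \<longrightarrow> geodesic X' (i A) (i B) (\<Phi> (A, B) 0))"
    if AB: "(A, B) \<in> E" for A B
  proof -
    obtain x where x: "x \<in> S" "unordered_pair x0 x = (A, B)" using AB unfolding E_def by (elim imageE) simp
    have xc: "x \<in> conf_pairs" using x(1) by (simp add: S_def)
    define y where "y = matched x"
    define p q where "p = fst y" and "q = snd y"
    have ypq: "y = (p, q)" by (simp add: p_def q_def)
    have yc: "y \<in> conf_pairs" unfolding y_def by (rule matched_in[OF xc])
    have pc: "p \<in> ordered_conf" and qc: "q \<in> ordered_conf" using yc ypq by auto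
    have ipy: "0 \<le> gap_inner y" unfolding y_def by (rule gap_inner_matched)
    have fx: "fst x = p" by (simp add: p_def y_def)
    have qx: "q = snd x \<or> q = prod.swap (snd x)" unfolding q_def y_def by (rule snd_matched)
    have AB': "A = unordered x0 p" "B = unordered x0 q"
      using x(2) fx qx by (auto simp: unordered_pair_def case_prod_unfold)
    have iA: "i A = e p" and iB: "i B = e q" using e(2) pc qc AB' by simp_all
    define \<phi> where "\<phi> = \<Phi> (A, B)"
    have \<phi>: "\<phi> s t = e (detour y s t)" if "s \<in> {0..1}" "t \<in> {0..1}" for s t
      using \<Phi>_F[OF xc that] x(2) by (simp add: \<phi>_def F_def y_def)
    have \<phi>_ext: "\<phi> \<in> extensional {0..1}" "s \<in> {0..1} \<Longrightarrow> \<phi> s \<in> extensional {0..1}" for s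
      unfolding \<phi>_def using \<Phi>_ext by blast+
    have "\<phi> \<in> topspace (path_space (path_space (mtopology_of Y)))"
      using continuous_map_image_subset_topspace[OF cont\<Phi>] AB Esub unfolding \<phi>_def by auto
    then have \<phi>_cont: "continuous_map unit_interval (path_space (mtopology_of Y)) \<phi>"
      by (simp add: path_space_def map_set_def)
    have \<phi>_path: "continuous_map unit_interval (mtopology_of Y) (\<phi> s)" if "s \<in> {0..1}" for s
    proof -
      have "\<phi> s \<in> topspace (path_space (mtopology_of Y))"
        using continuous_map_image_subset_topspace[OF \<phi>_cont] that by (auto simp: image_subset_iff)
      then show ?thesis by (simp add: path_space_def map_set_def)
    qed
    have ends: "\<phi> s 0 = i A" "\<phi> s 1 = i B" if "s \<in> {0..1}" for s
      using \<phi>[OF that] by (simp_all add: iA iB p_def q_def)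
    have in_between: "\<phi> s \<in> topspace (path_space_between (mtopology_of Y) (i A) (i B))" if "s \<in> {0..1}" for s
      unfolding topspace_path_space_between using \<phi>_path[OF that] \<phi>_ext(2)[OF that] ends[OF that] by simp
    have in_X': "\<phi> s \<in> topspace (path_space_between (mtopology_of X') (i A) (i B))"
      if s: "s \<in> {0..1}" and conf: "\<And>t. t \<in> {0..1} \<Longrightarrow> detour y s t \<in> ordered_conf" for s
    proof -
      have "\<phi> s t \<in> i ` mspace (conf_metric x0)" if t: "t \<in> {0..1}" for t
        using \<phi>[OF s t] e(2)[OF conf[OF t]] conf[OF t] unfolding unordered_image[symmetric] by simp
      then have "continuous_map unit_interval (mtopology_of X') (\<phi> s)"
        unfolding X'_def mtopology_of_submetric
        using \<phi>_path[OF s] by (intro continuous_map_into_subtopology) auto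
      then show ?thesis
        unfolding topspace_path_space_between using \<phi>_ext(2)[OF s] ends[OF s] by simp
    qed
    have D: "mdist Y (i A) (i B) = dist p q"
      unfolding iA iB ud using ipy unfolding ypq by (rule udist_eq_dist)
    have d0: "detour y 0 t = line p q t" for t
      unfolding detour_0 line_def p_def q_def ..
    have dist0: "mdist Y (\<phi> 0 t) (\<phi> 0 t') = \<bar>t - t'\<bar> * mdist Y (i A) (i B)"
      if "t \<in> {0..1}" "t' \<in> {0..1}" for t t'
    proof -
      have "mdist Y (\<phi> 0 t) (\<phi> 0 t') = udist (line p q t) (line p q t')"
        using \<phi>[of 0] that by (simp add: ud d0)
      then show ?thesis using udist_line[of p q t t'] that ipy D by (simp add: ypq)
    qed
    have geo0: "geodesic Y (i A) (i B) (\<phi> 0)"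
      unfolding geodesic_def using in_between[of 0] dist0 by simp
    have inside: "\<phi> ` {0<..1} \<subseteq> topspace (path_space_between (mtopology_of X') (i A) (i B))"
    proof (rule image_subsetI)
      fix s :: real assume s: "s \<in> {0<..1}"
      show "\<phi> s \<in> topspace (path_space_between (mtopology_of X') (i A) (i B))"
        by (rule in_X') (use s detour_in_conf[OF yc ipy] in auto)
    qed
    have len: "path_length Y (\<phi> s) \<le> ereal (dist p q + 2 * (s * clearance y))" if s: "s \<in> {0..1}" for s
    proof (rule path_length_le)
      fix t t' :: real assume t: "t \<in> {0..1}" "t' \<in> {0..1}"
      have "mdist Y (\<phi> s t) (\<phi> s t') \<le> dist (detour y s t) (detour y s t')"
        unfolding \<phi>[OF s t(1)] \<phi>[OF s t(2)] ud udist_def by (rule min.cobounded1)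
      also have "\<dots> \<le> \<bar>t - t'\<bar> * (dist p q + 2 * (s * clearance y))"
        unfolding p_def q_def by (rule detour_Lipschitz[OF yc]) (use s t in auto)
      finally show "mdist Y (\<phi> s t) (\<phi> s t') \<le> \<bar>t - t'\<bar> * (dist p q + 2 * (s * clearance y))" .
    next
      show "0 \<le> dist p q + 2 * (s * clearance y)"
        using s clearance_pos[OF yc] by simp
    qed
    have len_ge: "ereal (dist p q) \<le> path_length Y (\<phi> s)" if "s \<in> {0..1}" for s
      using path_length_ge[of Y "\<phi> s"] ends[OF that] D by simp
    have len0: "path_length Y (\<phi> 0) = ereal (dist p q)"
      using len[of 0] len_ge[of 0] by (intro antisym) simp_all
    have lim: "(\<lambda>n. path_length Y (\<phi> (s n))) \<longlonglongrightarrow> path_length Y (\<phi> 0)"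
      if s: "range s \<subseteq> {0..1}" "s \<longlonglongrightarrow> 0" for s :: "nat \<Rightarrow> real"
    proof (rule tendsto_sandwich)
      have sn: "s n \<in> {0..1}" for n using s(1) by (rule subsetD) (rule rangeI)
      show "\<forall>\<^sub>F n in sequentially. ereal (dist p q) \<le> path_length Y (\<phi> (s n))"
        using len_ge[OF sn] by simp
      show "\<forall>\<^sub>F n in sequentially. path_length Y (\<phi> (s n)) \<le> ereal (dist p q + 2 * (s n * clearance y))"
        using len[OF sn] by simp
      show "(\<lambda>n. ereal (dist p q)) \<longlonglongrightarrow> path_length Y (\<phi> 0)" unfolding len0 by simp
      have "(\<lambda>n. dist p q + 2 * (s n * clearance y)) \<longlonglongrightarrow> dist p q + 2 * (0 * clearance y)"
        by (intro tendsto_intros s(2))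
      then show "(\<lambda>n. ereal (dist p q + 2 * (s n * clearance y))) \<longlonglongrightarrow> path_length Y (\<phi> 0)"
        unfolding len0 by simp
    qed
    have "continuous_map unit_interval (path_space_between (mtopology_of Y) (i A) (i B)) \<phi>"
      unfolding path_space_between_def
      by (rule continuous_map_into_subtopology[OF \<phi>_cont]) (use ends in auto)
    then have "near_geodesic Y X' (i A) (i B) \<phi>"
      unfolding near_geodesic_def using geo0 inside lim by blast
    moreover have "geodesic X' (i A) (i B) (\<phi> 0)" if \<gamma>: "geodesic X' (i A) (i B) \<gamma>" for \<gamma>
    proof -
      have mX': "mdist X' a b = mdist Y a b" for a b by (simp add: X'_def)
      have \<gamma>c: "continuous_map unit_interval (mtopology_of X') \<gamma>" "\<gamma> 0 = i A" "\<gamma> 1 = i B"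
        and \<gamma>d: "\<And>t t'. t \<in> {0..1} \<Longrightarrow> t' \<in> {0..1} \<Longrightarrow> mdist Y (\<gamma> t) (\<gamma> t') = \<bar>t - t'\<bar> * mdist Y (i A) (i B)"
        using \<gamma> unfolding geodesic_def topspace_path_space_between mX' by blast+
      have "\<exists>r. r \<in> ordered_conf \<and> \<gamma> t = e r" if "t \<in> {0..1}" for t
      proof -
        have "\<gamma> t \<in> topspace (mtopology_of X')"
          using continuous_map_image_subset_topspace[OF \<gamma>c(1)] that by auto
        then have "\<gamma> t \<in> i ` unordered x0 ` ordered_conf" unfolding unordered_image by (simp add: X'_def)
        then obtain r where "r \<in> ordered_conf" "\<gamma> t = i (unordered x0 r)" by (elim imageE) simp
        then show ?thesis using e(2) by (intro exI[of _ r]) simp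
      qed
      then obtain r where r: "\<And>t. t \<in> {0..1} \<Longrightarrow> r t \<in> ordered_conf" "\<And>t. t \<in> {0..1} \<Longrightarrow> \<gamma> t = e (r t)"
        by metis
      have uq: "udist a (snd x) = udist a q" for a using qx by (elim disjE) simp_all
      have iD: "mdist Y (i A) (i B) = udist p q" unfolding iA iB ud ..
      have "nhits (matched x) = 0"
      proof (rule geodesic_imp_no_hits[OF xc r(1)]; (unfold uq fx)?)
        fix t t' :: real assume t: "t \<in> {0..1}"
        show "udist p (r t) = t * udist p q"
          using \<gamma>d[of 0 t] t unfolding \<gamma>c(2) r(2)[OF t] iD unfolding iA ud by simp
        show "udist (r t) q = (1 - t) * udist p q"
          using \<gamma>d[of t 1] t unfolding \<gamma>c(3) r(2)[OF t] iD unfolding iB ud by simp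
        assume t': "t' \<in> {0..1}"
        show "udist (r t) (r t') = \<bar>t - t'\<bar> * udist p q"
          using \<gamma>d[OF t t'] unfolding r(2)[OF t] r(2)[OF t'] iD ud .
      qed
      then have "\<not> hits_fst y \<and> \<not> hits_snd y" by (simp add: y_def nhits_def)
      then have "\<phi> 0 \<in> topspace (path_space_between (mtopology_of X') (i A) (i B))"
        by (intro in_X' detour_in_conf[OF yc ipy]) auto
      then show ?thesis unfolding geodesic_def mX' using dist0 by simp
    qed
    ultimately show ?thesis unfolding \<phi>_def by blast
  qed
  have "ngmpr (conf_metric x0) E \<Phi>"
    unfolding ngmpr_def Let_def Y_def[symmetric] i_def[symmetric] X'_def[symmetric]
    using cont\<Phi> near by (auto simp: path_space_def)
  then show ?thesis unfolding E_def S_def by blast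
qed

text \<open>The strata for the codimensions \<open>0\<close> to \<open>3\<close> partition the space, because the codimension depends on the
  unordered pairs only.\<close>
lemma GC_le_3: "GC (conf_metric x0) \<le> 3"
proof -
  define E where "E j = unordered_pair x0 ` {x \<in> conf_pairs. codim x = j}" for j
  have sub: "E j \<subseteq> mspace (conf_metric x0) \<times> mspace (conf_metric x0)" for j
    unfolding E_def unordered_pair_image[symmetric] by (rule image_mono) blast
  have "(\<Union>j\<le>3. E j) = mspace (conf_metric x0) \<times> mspace (conf_metric x0)"
  proof
    show "mspace (conf_metric x0) \<times> mspace (conf_metric x0) \<subseteq> (\<Union>j\<le>3. E j)"
      unfolding unordered_pair_image[symmetric] E_def using codim_le_3 by blast
  qed (use sub in blast)
  moreover have "disjoint_family_on E {..3}"
    unfolding disjoint_family_on_def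
  proof (intro ballI impI)
    fix j k :: nat assume "j \<noteq> k"
    show "E j \<inter> E k = {}"
    proof (rule ccontr)
      assume "E j \<inter> E k \<noteq> {}"
      then obtain x where x: "x \<in> conf_pairs" "codim x = j" "unordered_pair x0 x \<in> E k"
        unfolding E_def[of j] by blast
      then have "x \<in> {x \<in> conf_pairs. codim x = k}"
        unfolding E_def by (subst codim_stratum_saturated) simp
      then show False using x(2) \<open>j \<noteq> k\<close> by simp
    qed
  qed
  moreover have "locally_compact_space (subtopology (pair_topology x0) (E j))" for j
  proof (rule locally_compact_space_continuous_open_map_image)
    have sat: "{x \<in> conf_pairs. codim x = j} = {x \<in> conf_pairs. unordered_pair x0 x \<in> E j}"
      unfolding E_def by (rule codim_stratum_saturated)
    show "continuous_map (top_of_set {x \<in> conf_pairs. codim x = j}) (subtopology (pair_topology x0) (E j)) (unordered_pair x0)"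
      "open_map (top_of_set {x \<in> conf_pairs. codim x = j}) (subtopology (pair_topology x0) (E j)) (unordered_pair x0)"
      by (rule quotient_map_unordered_pair[OF sat sub])+
    show "unordered_pair x0 ` topspace (top_of_set {x \<in> conf_pairs. codim x = j}) = topspace (subtopology (pair_topology x0) (E j))"
      using sub[of j] by (auto simp: E_def)
  qed (rule locally_compact_codim_stratum)
  ultimately have "lc_partition (mtopology_of (conf_metric x0)) 3 E"
    by (simp add: lc_partition_def)
  moreover have "\<forall>j\<le>3. \<exists>\<Phi>. ngmpr (conf_metric x0) (E j) \<Phi>"
    unfolding E_def using ngmpr_codim_stratum by blast
  ultimately have "GC (conf_metric x0) \<le> enat 3"
    unfolding GC_def by (intro Inf_lower) blast
  then show ?thesis by (simp add: numeral_eq_enat)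
qed

end

theorem theorem2p12:
  fixes x0 :: "real ^ 2"
  shows "GC (conf2_metric (UNIV - {x0})) = 3 \<and> TC (mtopology_of (conf2_metric (UNIV - {x0}))) = 3"
  using TC_ge_3[of x0] GC_le_3[of x0] TC_le_GC[of "conf_metric x0"] by (auto intro: antisym order_trans)

end
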